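(* (1) Let $3\le t\le 6$ and let $p_1,\dots,p_t$ be distinct primes with $p_i\le 19$ for $i=1,\dots,t$. Then every solution in non-negative integers $\alpha_1,\dots,\alpha_t$ of $$p_1^{\alpha_1}+\dots+p_{t-1}^{\alpha_{t-1}}-p_t^{\alpha_t}=0$$ satisfies $\min_{1\le i\le t}\alpha_i\le 15$. (2) The equation $$3^{\alpha_1}+5^{\alpha_2}+11^{\alpha_3}+13^{\alpha_4}+17^{\alpha_5}-19^{\alpha_6}=0$$ has exactly two solutions in non-negative integers $\alpha_1,\dots,\alpha_6$, namely $(\alpha_1,\dots,\alpha_6)=(0,1,1,0,0,1)$ and $(1,0,0,1,0,1)$. *)

theory Defs
  imports "HOL-Computational_Algebra.Primes"
begin

end

theory Submission
  imports Defs "HOL-Number_Theory.Cong"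
begin

text \<open>
  Modulo \<open>q\<close>, a power \<open>p ^ a\<close> depends only on \<open>a\<close> modulo the order of \<open>p\<close>, and it vanishes if
  \<open>q\<close> divides \<open>p ^ 16\<close> and \<open>a \<ge> 16\<close>. Going through a list of prime powers \<open>q\<close> whose unit groups
  have smooth order, one keeps the set of exponent classes compatible with the equation modulo all
  \<open>q\<close> seen so far, refining the classes whenever the next order demands it. For every choice of primes
  this set becomes empty, so that the equation has no solution with all exponents at least 16. The
  classes surviving a modulus are found by meeting in the middle: the sums of one half of the terms
  are matched with the differences of the other half.

  For the second equation the same sieve applies after splitting each exponent into the cases 0 and at
  least 1. Only \<open>3 + 5 ^ b + 11 ^ c = 19 ^ f\<close> and \<open>3 + 3 ^ a + 13 ^ d = 19 ^ f\<close> survive; splitting once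
  more into the exponents 1 and at least 2 leaves the two solutions.
\<close>

section \<open>Residues as binary numerals\<close>

datatype difference = Below | Same | Above num

text \<open>\<open>diff_even\<close>, \<open>diff_succ\<close> and \<open>diff_pred\<close> send a
  difference d to 2 d, 2 d + 1 and 2 d - 1, the possible effects of one more low bit. All three keep
  a negative d negative.\<close>

fun diff_even :: "difference \<Rightarrow> difference" where
  "diff_even Below = Below"
| "diff_even Same = Same"
| "diff_even (Above d) = Above (num.Bit0 d)"

fun diff_succ :: "difference \<Rightarrow> difference" where
  "diff_succ Below = Below"
| "diff_succ Same = Above num.One"
| "diff_succ (Above d) = Above (num.Bit1 d)"

fun diff_pred :: "difference \<Rightarrow> difference" where
  "diff_pred Below = Below"
| "diff_pred Same = Below"
| "diff_pred (Above d) = Above (Num.BitM d)"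

fun num_diff :: "num \<Rightarrow> num \<Rightarrow> difference" where
  "num_diff num.One num.One = Same"
| "num_diff num.One (num.Bit0 n) = Below"
| "num_diff num.One (num.Bit1 n) = Below"
| "num_diff (num.Bit0 m) num.One = Above (Num.BitM m)"
| "num_diff (num.Bit1 m) num.One = Above (num.Bit0 m)"
| "num_diff (num.Bit0 m) (num.Bit0 n) = diff_even (num_diff m n)"
| "num_diff (num.Bit1 m) (num.Bit1 n) = diff_even (num_diff m n)"
| "num_diff (num.Bit1 m) (num.Bit0 n) = diff_succ (num_diff m n)"
| "num_diff (num.Bit0 m) (num.Bit1 n) = diff_pred (num_diff m n)"

fun same_num :: "num \<Rightarrow> num \<Rightarrow> bool" where
  "same_num num.One num.One = True"
| "same_num num.One (num.Bit0 n) = False"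
| "same_num num.One (num.Bit1 n) = False"
| "same_num (num.Bit0 m) num.One = False"
| "same_num (num.Bit1 m) num.One = False"
| "same_num (num.Bit0 m) (num.Bit0 n) = same_num m n"
| "same_num (num.Bit1 m) (num.Bit1 n) = same_num m n"
| "same_num (num.Bit1 m) (num.Bit0 n) = False"
| "same_num (num.Bit0 m) (num.Bit1 n) = False"

lemma num_diff_spec:
  "case num_diff m n of
     Below \<Rightarrow> (numeral m :: int) < numeral n
   | Same \<Rightarrow> m = n
   | Above d \<Rightarrow> (numeral m :: int) = numeral n + numeral d"
proof (induction m n rule: num_diff.induct)
  case (4 m)
  show ?case
    by (simp only: num_diff.simps difference.case numeral_BitM numeral_One add.commute[of 1]
        diff_add_cancel)
next
  case (9 m n)
  have double: "x + x = y + y + 1 + (z + z - 1)" if "x = y + z" for x y z :: int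
    using that by simp
  show ?case
  proof (cases "num_diff m n")
    case (Above d)
    then have "(numeral m :: int) = numeral n + numeral d"
      using 9 by simp
    then show ?thesis
      unfolding num_diff.simps Above diff_pred.simps difference.case
        numeral_BitM numeral_Bit0 numeral_Bit1
      by (rule double)
  qed (use 9 in simp_all)
qed (auto split: difference.splits)

lemma num_diff_Below: "num_diff m n = Below \<Longrightarrow> (numeral m :: int) < numeral n"
  and num_diff_Same: "num_diff m n = Same \<Longrightarrow> m = n"
  and num_diff_Above: "num_diff m n = Above d \<Longrightarrow> (numeral m :: int) = numeral n + numeral d"
  using num_diff_spec[of m n] by simp_all

lemma same_num_iff: "same_num m n \<longleftrightarrow> m = n"
  by (induction m n rule: same_num.induct) auto

text \<open>The residue classes modulo \<open>q\<close> are represented by \<open>1, \<dots>, q\<close>, so that every residue is a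
  value of type \<^typ>\<open>num\<close>; the class of \<open>0\<close> is represented by \<open>q\<close>.\<close>

definition residue :: "num \<Rightarrow> num \<Rightarrow> int \<Rightarrow> bool" where
  "residue q v x \<longleftrightarrow> v \<le> q \<and> [numeral v = x] (mod numeral q)"

lemma residueI: "(numeral v :: int) \<le> numeral q \<Longrightarrow> [numeral v = x] (mod numeral q) \<Longrightarrow> residue q v x"
  and residue_le: "residue q v x \<Longrightarrow> (numeral v :: int) \<le> numeral q"
  and residue_num_cong: "residue q v x \<Longrightarrow> [numeral v = x] (mod numeral q)"
  by (simp_all only: residue_def numeral_le_iff)

text \<open>Both numbers lie among \<open>q\<close> consecutive integers, so their difference is
  smaller than \<open>q\<close> in absolute value and, being divisible by \<open>q\<close>,
  vanishes.\<close>

lemma cong_positive_residues_eq: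
  fixes v w q :: int
  assumes "0 < v" "v \<le> q" "0 < w" "w \<le> q" "[v = w] (mod q)"
  shows "v = w"
proof (rule ccontr)
  assume "v \<noteq> w"
  then have "\<bar>q\<bar> \<le> \<bar>v - w\<bar>"
    using assms(5) by (intro dvd_imp_le_int) (simp_all add: cong_iff_dvd_diff)
  then show False
    using assms by linarith
qed

lemma residue_unique:
  assumes "residue q v x" "residue q w y" "[x = y] (mod numeral q)"
  shows "v = w"
proof -
  have "[numeral v = (numeral w :: int)] (mod numeral q)"
    using residue_num_cong[OF assms(1)] residue_num_cong[OF assms(2)] assms(3)
    by (meson cong_sym cong_trans)
  then have "(numeral v :: int) = numeral w"
    by (intro cong_positive_residues_eq[of _ "numeral q"] zero_less_numeral
        residue_le[OF assms(1)] residue_le[OF assms(2)])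
  then show ?thesis
    by (simp only: numeral_eq_iff)
qed

lemma residue_cong: "residue q v x \<Longrightarrow> [x = y] (mod numeral q) \<Longrightarrow> residue q v y"
  using residueI residue_le residue_num_cong cong_trans by blast

fun select_reduced :: "num \<Rightarrow> difference \<Rightarrow> num" where
  "select_reduced s Below = s"
| "select_reduced s Same = s"
| "select_reduced s (Above d) = d"

definition reduce :: "num \<Rightarrow> num \<Rightarrow> num" where
  "reduce q s = select_reduced s (num_diff s q)"

definition add_mod :: "num \<Rightarrow> num \<Rightarrow> num \<Rightarrow> num" where
  "add_mod q a b = reduce q (a + b)"

text \<open>\<open>Same\<close> is the class of 0, its own negative, represented by
  \<open>q\<close>. \<open>Below\<close> cannot occur for a residue; its value is a
  placeholder.\<close>

fun select_negated :: "num \<Rightarrow> difference \<Rightarrow> num" where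
  "select_negated q Below = q"
| "select_negated q Same = q"
| "select_negated q (Above d) = d"

definition neg_mod :: "num \<Rightarrow> num \<Rightarrow> num" where
  "neg_mod q a = select_negated q (num_diff q a)"

fun mul_mod :: "num \<Rightarrow> num \<Rightarrow> num \<Rightarrow> num" where
  "mul_mod q a num.One = a"
| "mul_mod q a (num.Bit0 b) = reduce q (num.Bit0 (mul_mod q a b))"
| "mul_mod q a (num.Bit1 b) = add_mod q a (reduce q (num.Bit0 (mul_mod q a b)))"

definition square_mod :: "num \<Rightarrow> num \<Rightarrow> num" where
  "square_mod q a = mul_mod q a a"

text \<open>The base may exceed \<open>q\<close>; multiplying the residue 1 by it reduces it
  first.\<close>

fun power_mod :: "num \<Rightarrow> num \<Rightarrow> num \<Rightarrow> num" where
  "power_mod q a num.One = mul_mod q num.One a"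
| "power_mod q a (num.Bit0 e) = square_mod q (power_mod q a e)"
| "power_mod q a (num.Bit1 e) = mul_mod q (square_mod q (power_mod q a e)) a"

text \<open>A sum of two representatives is at most \<open>q + q\<close>, so one conditional
  subtraction of \<open>q\<close> brings it back into range.\<close>

lemma residue_reduce:
  assumes "(numeral s :: int) \<le> numeral q + numeral q" "[numeral s = x] (mod numeral q)"
  shows "residue q (reduce q s) x"
proof (cases "num_diff s q")
  case Below
  have "residue q s x"
    using num_diff_Below[OF Below] assms(2) by (intro residueI) simp_all
  then show ?thesis
    by (simp only: reduce_def Below select_reduced.simps)
next
  case Same
  have "residue q s x"
    using num_diff_Same[OF Same] assms(2) by (intro residueI) simp_all
  then show ?thesis
    by (simp only: reduce_def Same select_reduced.simps)
next
  case (Above d)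
  have e: "(numeral s :: int) = numeral q + numeral d"
    by (rule num_diff_Above[OF Above])
  have "[numeral d = (numeral s :: int)] (mod numeral q)"
    by (simp only: e cong_def mod_add_self1)
  then have "[numeral d = x] (mod numeral q)"
    using assms(2) by (rule cong_trans)
  moreover have "(numeral d :: int) \<le> numeral q"
    using assms(1) unfolding e by (rule add_le_imp_le_left)
  ultimately have "residue q d x"
    by (intro residueI)
  then show ?thesis
    by (simp only: reduce_def Above select_reduced.simps)
qed

lemma residue_double:
  assumes "residue q v x"
  shows "residue q (reduce q (num.Bit0 v)) (x + x)"
  by (rule residue_reduce; unfold numeral_Bit0)
    (intro add_mono cong_add residue_le[OF assms] residue_num_cong[OF assms])+

lemma residue_add:
  assumes "residue q v x" "residue q w y"
  shows "residue q (add_mod q v w) (x + y)"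
  unfolding add_mod_def
  by (rule residue_reduce; unfold numeral_add)
    (intro add_mono cong_add residue_le[OF assms(1)] residue_le[OF assms(2)]
      residue_num_cong[OF assms(1)] residue_num_cong[OF assms(2)])+

lemma residue_neg:
  assumes "residue q v x"
  shows "residue q (neg_mod q v) (- x)"
proof -
  \<comment> \<open>Turns the claim into divisibility of \<open>w + v\<close> by \<open>q\<close>;
    in the two possible cases this sum is \<open>q + q\<close> or \<open>q\<close>.\<close>
  have *: "residue q w (- x)"
    if "(numeral w :: int) \<le> numeral q" "(numeral q :: int) dvd numeral w + numeral v" for w
  proof (rule residueI[OF that(1)])
    have "[numeral w = - (numeral v :: int)] (mod numeral q)"
      using that(2) by (simp only: cong_iff_dvd_diff diff_minus_eq_add)
    moreover have "[- numeral v = - x] (mod numeral q)"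
      using residue_num_cong[OF assms] by (simp only: cong_minus_minus_iff)
    ultimately show "[numeral w = - x] (mod numeral q)"
      by (rule cong_trans)
  qed
  show ?thesis
  proof (cases "num_diff q v")
    case Below
    then show ?thesis
      using num_diff_Below[OF Below] residue_le[OF assms] by linarith
  next
    case Same
    have "q = v"
      by (rule num_diff_Same[OF Same])
    then have "residue q q (- x)"
      using *[OF order_refl] dvd_add[OF dvd_refl dvd_refl] by blast
    then show ?thesis
      by (simp only: neg_mod_def Same select_negated.simps)
  next
    case (Above d)
    have e: "(numeral q :: int) = numeral v + numeral d"
      by (rule num_diff_Above[OF Above])
    have "residue q d (- x)"
    proof (rule *)
      show "(numeral d :: int) \<le> numeral q"
        unfolding e using zero_le_numeral by (rule le_add_same_cancel2[THEN iffD2])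
      show "(numeral q :: int) dvd numeral d + numeral v"
        unfolding e by (simp only: add.commute dvd_refl)
    qed
    then show ?thesis
      by (simp only: neg_mod_def Above select_negated.simps)
  qed
qed

lemma residue_One: "residue q num.One 1"
  by (rule residueI) simp_all

lemma residue_mul:
  "residue q v x \<Longrightarrow> residue q (mul_mod q v w) (x * numeral w)"
proof (induction w)
  case One
  then show ?case
    by (simp only: mul_mod.simps numeral_One mult_1_right)
next
  case (Bit0 w)
  have "residue q (mul_mod q v (num.Bit0 w)) (x * numeral w + x * numeral w)"
    unfolding mul_mod.simps by (rule residue_double[OF Bit0.IH[OF Bit0.prems]])
  then show ?case
    by (simp only: numeral_Bit0 distrib_left)
next
  case (Bit1 w)
  have "residue q (mul_mod q v (num.Bit1 w)) (x + (x * numeral w + x * numeral w))"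
    unfolding mul_mod.simps
    by (rule residue_add[OF Bit1.prems residue_double[OF Bit1.IH[OF Bit1.prems]]])
  then show ?case
    by (simp only: numeral_Bit1 distrib_left mult_1 mult_1_right ac_simps)
qed

lemma residue_mult:
  assumes "residue q v x" "residue q w y"
  shows "residue q (mul_mod q v w) (x * y)"
  by (rule residue_cong[OF residue_mul[OF assms(1)]])
    (intro cong_mult cong_refl residue_num_cong[OF assms(2)])

lemma residue_power: "residue q (power_mod q a e) (numeral a ^ numeral e)"
proof (induction e)
  case One
  show ?case
    using residue_mul[OF residue_One] by (simp only: power_mod.simps numeral_One power_one_right mult_1)
next
  case (Bit0 e)
  show ?case
    using residue_mult[OF Bit0 Bit0]
    by (simp only: power_mod.simps square_mod_def numeral_Bit0 power_add)
next
  case (Bit1 e)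
  show ?case
    using residue_mul[OF residue_mult[OF Bit1 Bit1], of a]
    by (simp only: power_mod.simps square_mod_def numeral_Bit1 power_add power_one_right)
qed

lemmas arith_eval =
  add_num_simps Num.BitM.simps diff_even.simps diff_succ.simps diff_pred.simps num_diff.simps
  same_num.simps select_reduced.simps reduce_def add_mod_def select_negated.simps neg_mod_def
  mul_mod.simps square_mod_def power_mod.simps

section \<open>Exponent classes and tables of powers\<close>

type_synonym exponent_class = "nat list list"

type_synonym valued_class = "num \<times> exponent_class"

text \<open>An exponent class is a list of digit lists: the \<open>i\<close>-th one holds the lowest digits, least
  significant first, of the exponent \<open>a\<close> in base \<open>l\<close>, the \<open>i\<close>-th of the primes 2, 3, 5, 7, 11, 13.
  Modulo \<open>q\<close> a base is a product of factors of \<open>l\<close>-power order, one for each \<open>l\<close>, so that \<open>p ^ a\<close>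
  is a product of digit contributions. The levels of a ladder list the contributions of the
  successive digits; an empty level marks the passage to the next prime. A trie is such a ladder with
  the partial products multiplied out; \<open>Gen v L\<close> leaves the ladder \<open>L\<close> to be multiplied on demand.
  Looking up a class with too few digits enumerates its refinements.\<close>

datatype trie = Leaf num | Next trie | Node "trie list" | Gen num "num list list"

fun prepend_digit :: "nat \<Rightarrow> valued_class list \<Rightarrow> valued_class list" where
  "prepend_digit d [] = []"
| "prepend_digit d ((v, []) # r) = (v, [[d]]) # prepend_digit d r"
| "prepend_digit d ((v, y # ys) # r) = (v, (d # y) # ys) # prepend_digit d r"

fun prepend_block :: "nat list \<Rightarrow> valued_class list \<Rightarrow> valued_class list" where
  "prepend_block x [] = []"
| "prepend_block x ((v, ys) # r) = (v, x # ys) # prepend_block x r"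

fun ladder_look :: "num \<Rightarrow> num \<Rightarrow> num list list \<Rightarrow> exponent_class \<Rightarrow> valued_class list" where
  "ladder_look q v [] xs = [(v, xs)]"
| "ladder_look q v ([] # L) [] = prepend_block [] (ladder_look q v L [])"
| "ladder_look q v ([] # L) (x # xs) = prepend_block x (ladder_look q v L xs)"
| "ladder_look q v ((h # hs) # L) [] =
     concat (map (\<lambda>(d, g). prepend_digit d (ladder_look q (mul_mod q v g) L [[]]))
       (enumerate 0 (h # hs)))"
| "ladder_look q v ((h # hs) # L) ([] # xs) =
     concat (map (\<lambda>(d, g). prepend_digit d (ladder_look q (mul_mod q v g) L ([] # xs)))
       (enumerate 0 (h # hs)))"
| "ladder_look q v ((h # hs) # L) ((d # ds) # xs) =
     (if d < length (h # hs)
      then prepend_digit d (ladder_look q (mul_mod q v ((h # hs) ! d)) L (ds # xs)) else [])"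

definition ladder_branches ::
    "num \<Rightarrow> num \<Rightarrow> nat \<Rightarrow> num list \<Rightarrow> num list list \<Rightarrow> exponent_class \<Rightarrow> valued_class list" where
  "ladder_branches q v d hs L xs =
     concat (map (\<lambda>(d, g). prepend_digit d (ladder_look q (mul_mod q v g) L ([] # xs)))
       (enumerate d hs))"

definition ladder_branch ::
    "num \<Rightarrow> num \<Rightarrow> num list \<Rightarrow> nat \<Rightarrow> num list list \<Rightarrow> exponent_class \<Rightarrow> valued_class list" where
  "ladder_branch q v hs d L xs =
     (if d < length hs then ladder_look q (mul_mod q v (hs ! d)) L xs else [])"

lemma ladder_branches_eval:
  "ladder_branches q v d [] L xs = []"
  "ladder_branches q v d (h # hs) L xs =
     prepend_digit d (ladder_look q (mul_mod q v h) L ([] # xs)) @ ladder_branches q v (Suc d) hs L xs"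
  by (simp_all add: ladder_branches_def)

lemma ladder_branch_eval:
  "ladder_branch q v [] d L xs = []"
  "ladder_branch q v (h # hs) 0 L xs = ladder_look q (mul_mod q v h) L xs"
  "ladder_branch q v (h # hs) (Suc d) L xs = ladder_branch q v hs d L xs"
  by (simp_all add: ladder_branch_def)

text \<open>Equations for evaluation by rewriting: the walk along a level is an explicit recursion,
  free of \<open>enumerate\<close>, list indexing and \<open>if\<close>.\<close>

lemma ladder_look_eval:
  "ladder_look q v [] xs = [(v, xs)]"
  "ladder_look q v ([] # L) [] = prepend_block [] (ladder_look q v L [])"
  "ladder_look q v ([] # L) (x # xs) = prepend_block x (ladder_look q v L xs)"
  "ladder_look q v ((h # hs) # L) [] = ladder_branches q v 0 (h # hs) L []"
  "ladder_look q v ((h # hs) # L) ([] # xs) = ladder_branches q v 0 (h # hs) L xs"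
  "ladder_look q v ((h # hs) # L) ((d # ds) # xs) =
     prepend_digit d (ladder_branch q v (h # hs) d L (ds # xs))"
  by (simp_all add: ladder_branches_def ladder_branch_def)

fun look :: "num \<Rightarrow> trie \<Rightarrow> exponent_class \<Rightarrow> valued_class list"
  and look_all :: "num \<Rightarrow> nat \<Rightarrow> trie list \<Rightarrow> exponent_class \<Rightarrow> valued_class list"
  and look_child :: "num \<Rightarrow> trie list \<Rightarrow> nat \<Rightarrow> exponent_class \<Rightarrow> valued_class list" where
  "look q (Leaf v) xs = [(v, xs)]"
| "look q (Next t) [] = prepend_block [] (look q t [])"
| "look q (Next t) (x # xs) = prepend_block x (look q t xs)"
| "look q (Node ts) [] = look_all q 0 ts []"
| "look q (Node ts) ([] # xs) = look_all q 0 ts xs"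
| "look q (Node ts) ((d # ds) # xs) = prepend_digit d (look_child q ts d (ds # xs))"
| "look q (Gen v L) xs = ladder_look q v L xs"
| "look_all q d [] xs = []"
| "look_all q d (t # ts) xs = prepend_digit d (look q t ([] # xs)) @ look_all q (Suc d) ts xs"
| "look_child q [] d xs = []"
| "look_child q (t # ts) 0 xs = look q t xs"
| "look_child q (t # ts) (Suc d) xs = look_child q ts d xs"

fun expand :: "num \<Rightarrow> num \<Rightarrow> num list list \<Rightarrow> trie" where
  "expand q v [] = Leaf v"
| "expand q v ([] # L) = Next (expand q v L)"
| "expand q v ((h # hs) # L) = Node (map (\<lambda>g. expand q (mul_mod q v g) L) (h # hs))"

definition expand_all :: "num \<Rightarrow> num \<Rightarrow> num list \<Rightarrow> num list list \<Rightarrow> trie list" where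
  "expand_all q v hs L = map (\<lambda>g. expand q (mul_mod q v g) L) hs"

lemma expand_eval:
  "expand q v [] = Leaf v"
  "expand q v ([] # L) = Next (expand q v L)"
  "expand q v ((h # hs) # L) = Node (expand_all q v (h # hs) L)"
  "expand_all q v [] L = []"
  "expand_all q v (h # hs) L = expand q (mul_mod q v h) L # expand_all q v hs L"
  by (simp_all add: expand_all_def)

text \<open>Multiplying out in advance or on demand yields the same list, so soundness has to be
  shown for ladders only.\<close>

lemma look_expand: "look q (expand q v L) xs = ladder_look q v L xs"
proof (induction L arbitrary: v xs)
  case Nil
  show ?case by simp
next
  case (Cons hs L)
  have all: "look_all q d (expand_all q v hs L) xs = ladder_branches q v d hs L xs" for d hs xs
    by (induction hs arbitrary: d) (simp_all add: expand_eval ladder_branches_eval Cons)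
  have child: "look_child q (expand_all q v hs L) d xs = ladder_branch q v hs d L xs" for d hs xs
  proof (induction hs arbitrary: d)
    case (Cons h hs)
    then show ?case
      by (cases d) (simp_all add: expand_eval ladder_branch_eval \<open>\<And>v xs. look q (expand q v L) xs = _\<close>)
  qed (simp add: expand_eval ladder_branch_eval)
  show ?case
  proof (cases hs)
    case Nil
    then show ?thesis by (cases xs) (simp_all add: Cons)
  next
    case (Cons h hs')
    show ?thesis
    proof (cases xs)
      case Nil
      then show ?thesis
        by (simp only: Cons expand_eval(3) look.simps ladder_look_eval all)
    next
      case (Cons x xs')
      then show ?thesis
        by (cases x) (simp_all only: \<open>hs = h # hs'\<close> expand_eval(3) look.simps ladder_look_eval all child)
    qed
  qed
qed

section \<open>Following the digits of an actual exponent\<close>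

fun digits_match :: "nat \<Rightarrow> nat list \<Rightarrow> nat \<Rightarrow> bool" where
  "digits_match l [] x \<longleftrightarrow> True"
| "digits_match l (d # ds) x \<longleftrightarrow> x mod l = d \<and> digits_match l ds (x div l)"

text \<open>Each pair holds a prime \<open>l\<close> and what is left of the exponent after its
  lower digits are stripped; digits and blocks that are not listed are unconstrained.\<close>

fun path_match :: "(nat \<times> nat) list \<Rightarrow> exponent_class \<Rightarrow> bool" where
  "path_match S [] \<longleftrightarrow> True"
| "path_match [] (ds # xs) \<longleftrightarrow> True"
| "path_match ((l, x) # S) (ds # xs) \<longleftrightarrow> digits_match l ds x \<and> path_match S xs"

fun ladder_value :: "num \<Rightarrow> num \<Rightarrow> (nat \<times> nat) list \<Rightarrow> num list list \<Rightarrow> num" where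
  "ladder_value q v S [] = v"
| "ladder_value q v S ([] # L) = ladder_value q v (tl S) L"
| "ladder_value q v [] ((h # hs) # L) = v"
| "ladder_value q v ((l, x) # S) ((h # hs) # L) =
     ladder_value q (mul_mod q v ((h # hs) ! (x mod l))) ((l, x div l) # S) L"

text \<open>Ensures that \<open>ladder_value\<close> never falls back on its default for an
  exhausted \<open>S\<close> and that every digit indexes an existing entry.\<close>

fun ladder_fits :: "(nat \<times> nat) list \<Rightarrow> num list list \<Rightarrow> bool" where
  "ladder_fits S [] \<longleftrightarrow> True"
| "ladder_fits [] ([] # L) \<longleftrightarrow> False"
| "ladder_fits (s # S) ([] # L) \<longleftrightarrow> ladder_fits S L"
| "ladder_fits [] ((h # hs) # L) \<longleftrightarrow> False"
| "ladder_fits ((l, x) # S) ((h # hs) # L) \<longleftrightarrow> length (h # hs) = l \<and> ladder_fits ((l, x div l) # S) L"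

lemma prepend_digit_in:
  "(v, ys) \<in> set r \<Longrightarrow>
   (v, case ys of [] \<Rightarrow> [[d]] | z # zs \<Rightarrow> (d # z) # zs) \<in> set (prepend_digit d r)"
  by (induction d r rule: prepend_digit.induct) auto

lemma prepend_block_in: "(v, ys) \<in> set r \<Longrightarrow> (v, x # ys) \<in> set (prepend_block x r)"
  by (induction x r rule: prepend_block.induct) auto

text \<open>The true digits mark one path. A recorded digit agrees with it and an unrecorded one is
  enumerated, so the path is never lost and its refined class still contains the exponent.\<close>

lemma ladder_look_complete:
  "ladder_fits S L \<Longrightarrow> path_match S xs \<Longrightarrow>
   \<exists>ys. (ladder_value q v S L, ys) \<in> set (ladder_look q v L xs) \<and> path_match S ys"
proof (induction L arbitrary: S v xs)
  case Nil
  then show ?case by auto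
next
  case (Cons hs L)
  show ?case
  proof (cases hs)
    case Nil
    then obtain s S' where S: "S = s # S'" "ladder_fits S' L"
      using Cons.prems(1) by (cases S) auto
    obtain l x where s: "s = (l, x)" by (cases s)
    show ?thesis
    proof (cases xs)
      case Nil
      obtain ys where "(ladder_value q v S' L, ys) \<in> set (ladder_look q v L [])" "path_match S' ys"
        using Cons.IH[OF S(2), of "[]"] by auto
      then show ?thesis
        using prepend_block_in[of _ ys _ "[]"] \<open>hs = []\<close> Nil S s
        by (auto intro!: exI[of _ "[] # ys"])
    next
      case (Cons z zs)
      then have m: "digits_match l z x" "path_match S' zs"
        using Cons.prems(2) S s by auto
      obtain ys where "(ladder_value q v S' L, ys) \<in> set (ladder_look q v L zs)" "path_match S' ys"
        using Cons.IH[OF S(2) m(2)] by auto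
      then show ?thesis
        using prepend_block_in[of _ ys _ z] \<open>hs = []\<close> Cons S s m
        by (auto intro!: exI[of _ "z # ys"])
    qed
  next
    case (Cons h hs')
    then obtain l x S' where S: "S = (l, x) # S'" "length hs = l" "ladder_fits ((l, x div l) # S') L"
      using Cons.prems(1) by (cases S) auto
    have l: "x mod l < length hs"
      using S(2) Cons by (metis length_greater_0_conv list.distinct(1) mod_less_divisor)
    define w where "w = mul_mod q v (hs ! (x mod l))"
    have val: "ladder_value q v S (hs # L) = ladder_value q w ((l, x div l) # S') L"
      using Cons S(1) by (simp add: w_def)
    \<comment> \<open>A class of \<open>x div l\<close> becomes a class of \<open>x\<close> once
      \<open>x mod l\<close> is put in front of its first block.\<close>
    have extend: "\<exists>ys. (u, ys) \<in> set (prepend_digit (x mod l) r) \<and> path_match S ys"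
      if "(u, zs) \<in> set r" "path_match ((l, x div l) # S') zs" for u zs r
    proof (cases zs)
      case Nil
      then show ?thesis
        using prepend_digit_in[OF that(1), of "x mod l"] S(1) by auto
    next
      case (Cons z zs')
      then show ?thesis
        using prepend_digit_in[OF that(1), of "x mod l"] that(2) S(1)
        by (auto intro!: exI[of _ "(x mod l # z) # zs'"])
    qed
    \<comment> \<open>If no digit is recorded, the branch of the true digit is among those
      enumerated.\<close>
    have branch: "prepend_digit (x mod l) (ladder_look q w L ([] # zs)) = r \<Longrightarrow>
        set r \<subseteq> set (ladder_branches q v 0 hs L zs)" for zs r
    proof -
      assume r: "prepend_digit (x mod l) (ladder_look q w L ([] # zs)) = r"
      have "(x mod l, hs ! (x mod l)) \<in> set (enumerate 0 hs)"
        using l by (simp add: in_set_enumerate_eq)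
      then show ?thesis
        using r unfolding ladder_branches_def w_def by force
    qed
    show ?thesis
    proof (cases "xs = [] \<or> (\<exists>zs. xs = [] # zs)")
      case True
      define zs where "zs = tl xs"
      have "path_match ((l, x div l) # S') ([] # zs)"
        using Cons.prems(2) True S(1) by (auto simp: zs_def)
      then obtain ys where
        "(ladder_value q w ((l, x div l) # S') L, ys) \<in> set (ladder_look q w L ([] # zs))"
        "path_match ((l, x div l) # S') ys"
        using Cons.IH[OF S(3)] by blast
      from extend[OF this] show ?thesis
        using branch[OF refl, of zs] True Cons val
        by (fastforce simp: zs_def ladder_look_eval simp del: ladder_look.simps)
    next
      case False
      then obtain d ds zs where xs: "xs = (d # ds) # zs"
        by (metis neq_Nil_conv)
      then have d: "d = x mod l" and m: "path_match ((l, x div l) # S') (ds # zs)"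
        using Cons.prems(2) S(1) by auto
      obtain ys where
        "(ladder_value q w ((l, x div l) # S') L, ys) \<in> set (ladder_look q w L (ds # zs))"
        "path_match ((l, x div l) # S') ys"
        using Cons.IH[OF S(3) m] by blast
      from extend[OF this] show ?thesis
        using xs d l Cons val by (auto simp: w_def)
    qed
  qed
qed

section \<open>Ladders for factors of prime power order\<close>

fun cons_option :: "'a \<Rightarrow> 'a list option \<Rightarrow> 'a list option" where
  "cons_option x None = None"
| "cons_option x (Some xs) = Some (x # xs)"

fun append_option :: "'a list option \<Rightarrow> 'a list option \<Rightarrow> 'a list option" where
  "append_option None ys = None"
| "append_option (Some xs) None = None"
| "append_option (Some xs) (Some ys) = Some (xs @ ys)"

fun powers_from :: "num \<Rightarrow> num \<Rightarrow> num \<Rightarrow> nat \<Rightarrow> num list" where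
  "powers_from q g v 0 = []"
| "powers_from q g v (Suc n) = v # powers_from q g (mul_mod q v g) n"

fun nat_power_mod :: "num \<Rightarrow> num \<Rightarrow> nat \<Rightarrow> num" where
  "nat_power_mod q g 0 = num.One"
| "nat_power_mod q g (Suc n) = mul_mod q (nat_power_mod q g n) g"

text \<open>Digit d at position i contributes \<open>g\<close> to the power d times \<open>l\<close>
  to the i. Each level therefore lists the powers of the current base and hands its
  \<open>l\<close>-th power down, until that power is 1. \<open>k\<close> is fuel, and
  \<open>None\<close> reports that 1 was not reached.\<close>

fun ladder :: "num \<Rightarrow> nat \<Rightarrow> nat \<Rightarrow> num \<Rightarrow> num list list option" where
  "ladder q l k num.One = Some [[]]"
| "ladder q l 0 (num.Bit0 g) = None"
| "ladder q l 0 (num.Bit1 g) = None"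
| "ladder q l (Suc k) (num.Bit0 g) =
     cons_option (powers_from q (num.Bit0 g) num.One l) (ladder q l k (nat_power_mod q (num.Bit0 g) l))"
| "ladder q l (Suc k) (num.Bit1 g) =
     cons_option (powers_from q (num.Bit1 g) num.One l) (ladder q l k (nat_power_mod q (num.Bit1 g) l))"

text \<open>Covers orders up to the 12th power of \<open>l\<close>.\<close>

definition ladder_height :: nat where
  "ladder_height = 12"

fun ladders :: "num \<Rightarrow> nat list \<Rightarrow> num list \<Rightarrow> num list list option" where
  "ladders q ls [] = Some []"
| "ladders q [] (g # gs) = None"
| "ladders q (l # ls) (g # gs) = append_option (ladder q l ladder_height g) (ladders q ls gs)"

lemma residue_powers_from:
  "residue q v y \<Longrightarrow> d < n \<Longrightarrow> residue q (powers_from q g v n ! d) (y * numeral g ^ d)"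
proof (induction n arbitrary: v y d)
  case (Suc n)
  show ?case
  proof (cases d)
    case 0
    then show ?thesis
      using Suc.prems(1) by simp
  next
    case (Suc d')
    then have "residue q (powers_from q g (mul_mod q v g) n ! d') (y * numeral g * numeral g ^ d')"
      using Suc.prems by (intro Suc.IH residue_mul) simp_all
    then show ?thesis
      by (simp only: Suc powers_from.simps nth_Cons_Suc power_Suc mult.assoc)
  qed
qed simp

lemma length_powers_from: "length (powers_from q g v n) = n"
  by (induction n arbitrary: v) simp_all

lemma residue_nat_power: "residue q (nat_power_mod q g n) (numeral g ^ n)"
proof (induction n)
  case 0
  show ?case
    using residue_One by (simp only: nat_power_mod.simps power_0)
next
  case (Suc n)
  show ?case
    using residue_mul[OF Suc, of g] by (simp only: nat_power_mod.simps power_Suc mult.commute)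
qed

text \<open>Stated for every continuation \<open>R\<close>, so that the ladders of successive primes
  can be chained.\<close>

definition ladder_evaluates :: "num \<Rightarrow> nat \<Rightarrow> nat \<Rightarrow> num list list \<Rightarrow> num \<Rightarrow> num \<Rightarrow> bool" where
  "ladder_evaluates q l x L v w \<longleftrightarrow>
     (\<forall>S R. ladder_value q v ((l, x) # S) (L @ R) = ladder_value q w S R \<and>
            (ladder_fits S R \<longrightarrow> ladder_fits ((l, x) # S) (L @ R)))"

text \<open>\<open>g ^ x\<close> is \<open>g ^ (x mod l)\<close> times
  \<open>(g ^ l) ^ (x div l)\<close>: the new level supplies the first factor, the rest of the
  ladder the second.\<close>

lemma ladder_step:
  assumes v: "residue q v y" and l: "0 < l"
    and IH: "\<And>v y x. residue q v y \<Longrightarrow>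
      \<exists>w. residue q w (y * numeral (nat_power_mod q g l) ^ x) \<and> ladder_evaluates q l x L v w"
  shows "\<exists>w. residue q w (y * numeral g ^ x) \<and>
    ladder_evaluates q l x (powers_from q g num.One l # L) v w"
proof -
  let ?h = "powers_from q g num.One l"
  have "residue q (?h ! (x mod l)) (1 * numeral g ^ (x mod l))"
    using l by (intro residue_powers_from residue_One) simp
  then have "residue q (mul_mod q v (?h ! (x mod l))) (y * (1 * numeral g ^ (x mod l)))"
    by (rule residue_mult[OF v])
  from IH[OF this, of "x div l"] obtain w where
    w: "residue q w (y * (1 * numeral g ^ (x mod l)) * numeral (nat_power_mod q g l) ^ (x div l))"
    and ev: "ladder_evaluates q l (x div l) L (mul_mod q v (?h ! (x mod l))) w"
    by blast
  have eq: "y * (1 * numeral g ^ (x mod l)) * (numeral g ^ l) ^ (x div l) = y * numeral g ^ x"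
    by (simp only: mult_1 mult.assoc power_mult[symmetric] power_add[symmetric] mod_mult_div_eq)
  have "residue q w (y * numeral g ^ x)"
    by (rule residue_cong[OF w], unfold eq[symmetric])
      (intro cong_mult cong_pow cong_refl residue_num_cong[OF residue_nat_power])
  moreover obtain h hs where "?h = h # hs"
    using l length_powers_from[of q g num.One l] by (cases ?h) auto
  then have "ladder_evaluates q l x (?h # L) v w"
    using ev length_powers_from[of q g num.One l] unfolding ladder_evaluates_def by auto
  ultimately show ?thesis
    by blast
qed

lemma ladder_sound:
  "ladder q l k g = Some L \<Longrightarrow> 0 < l \<Longrightarrow> residue q v y \<Longrightarrow>
   \<exists>w. residue q w (y * numeral g ^ x) \<and> ladder_evaluates q l x L v w"
proof (induction q l k g arbitrary: L v y x rule: ladder.induct)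
  case (1 q l k)
  then have "L = [[]]" by simp
  with 1 show ?case
    by (auto simp: ladder_evaluates_def intro!: exI[of _ v])
next
  case (4 q l k g)
  then obtain L' where "ladder q l k (nat_power_mod q (num.Bit0 g) l) = Some L'"
    and L: "L = powers_from q (num.Bit0 g) num.One l # L'"
    by (auto elim: cons_option.elims)
  then show ?case
    unfolding L using 4 by (intro ladder_step) blast+
next
  case (5 q l k g)
  then obtain L' where "ladder q l k (nat_power_mod q (num.Bit1 g) l) = Some L'"
    and L: "L = powers_from q (num.Bit1 g) num.One l # L'"
    by (auto elim: cons_option.elims)
  then show ?case
    unfolding L using 5 by (intro ladder_step) blast+
qed simp_all

section \<open>Bases as products of factors of prime power order\<close>

fun prod_mod :: "num \<Rightarrow> num list \<Rightarrow> num" where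
  "prod_mod q [] = num.One"
| "prod_mod q (g # gs) = mul_mod q (prod_mod q gs) g"

lemma residue_prod_mod: "residue q (prod_mod q gs) (\<Prod>g\<leftarrow>gs. numeral g)"
proof (induction gs)
  case Nil
  show ?case
    using residue_One by (simp only: prod_mod.simps list.map prod_list.Nil)
next
  case (Cons g gs)
  show ?case
    using residue_mul[OF Cons, of g]
    by (simp only: prod_mod.simps list.map prod_list.Cons mult.commute)
qed

lemma ladders_sound:
  "ladders q ls gs = Some L \<Longrightarrow> \<forall>l\<in>set ls. 0 < l \<Longrightarrow> residue q v y \<Longrightarrow>
   residue q (ladder_value q v (map (\<lambda>l. (l, x)) ls) L) (y * (\<Prod>g\<leftarrow>gs. numeral g) ^ x) \<and>
   ladder_fits (map (\<lambda>l. (l, x)) ls) L"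
proof (induction q ls gs arbitrary: L v y rule: ladders.induct)
  case (3 q l ls g gs)
  then obtain A B where A: "ladder q l ladder_height g = Some A" and B: "ladders q ls gs = Some B"
    and L: "L = A @ B"
    by (auto elim: append_option.elims)
  obtain w where w: "residue q w (y * numeral g ^ x)" and ev: "ladder_evaluates q l x A v w"
    using ladder_sound[OF A _ "3.prems"(3)] "3.prems"(2) by (meson list.set_intros(1))
  have "residue q (ladder_value q w (map (\<lambda>l. (l, x)) ls) B)
          (y * numeral g ^ x * (\<Prod>g\<leftarrow>gs. numeral g) ^ x) \<and> ladder_fits (map (\<lambda>l. (l, x)) ls) B"
    using "3.IH"[OF B _ w] "3.prems"(2) by (meson list.set_intros(2))
  then show ?case
    using ev unfolding L ladder_evaluates_def list.map prod_list.Cons power_mult_distrib mult.assoc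
    by metis
qed simp_all

definition base_primes :: "nat list" where
  "base_primes = [2, 3, 5, 7, 11, 13]"

definition class_match :: "exponent_class \<Rightarrow> nat \<Rightarrow> bool" where
  "class_match xs a \<longleftrightarrow> path_match (map (\<lambda>l. (l, a)) base_primes) xs"

text \<open>The lower bound \<open>m\<close> on the exponent serves bases whose powers vanish modulo
  \<open>q\<close> from exponent \<open>m\<close> on.\<close>

definition trie_sound :: "num \<Rightarrow> num \<Rightarrow> num \<Rightarrow> trie \<Rightarrow> bool" where
  "trie_sound m q p t \<longleftrightarrow>
     (\<forall>a xs. numeral m \<le> a \<longrightarrow> class_match xs a \<longrightarrow>
       (\<exists>v ys. (v, ys) \<in> set (look q t xs) \<and> residue q v (numeral p ^ a) \<and> class_match ys a))"

fun to_trie :: "num \<Rightarrow> bool \<Rightarrow> num list list option \<Rightarrow> trie option" where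
  "to_trie q b None = None"
| "to_trie q True (Some L) = Some (expand q num.One L)"
| "to_trie q False (Some L) = Some (Gen num.One L)"

fun guard :: "bool \<Rightarrow> 'a option \<Rightarrow> 'a option" where
  "guard True x = x"
| "guard False x = None"

fun powers_mod :: "num \<Rightarrow> num \<Rightarrow> num list \<Rightarrow> num list" where
  "powers_mod q p [] = []"
| "powers_mod q p (e # es) = power_mod q p e # powers_mod q p es"

text \<open>The factors are only a certificate: the guard verifies that their product is
  \<open>p\<close> modulo \<open>q\<close>, and the ladders verify their orders, so the listed
  exponents need not be trusted.\<close>

definition checked_trie :: "num \<Rightarrow> num \<Rightarrow> bool \<Rightarrow> num list \<Rightarrow> trie option" where
  "checked_trie q p b gs =
     guard (same_num (prod_mod q gs) (mul_mod q num.One p)) (to_trie q b (ladders q base_primes gs))"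

fun decomposed_trie :: "num \<Rightarrow> num \<Rightarrow> (bool \<times> num list) option \<Rightarrow> trie option" where
  "decomposed_trie q p None = None"
| "decomposed_trie q p (Some (b, es)) = checked_trie q p b (powers_mod q p es)"

lemma checked_trie_sound:
  assumes "checked_trie q p b gs = Some t"
  shows "trie_sound m q p t"
  unfolding trie_sound_def
proof (intro allI impI)
  fix a xs
  assume xs: "class_match xs a"
  have same: "prod_mod q gs = mul_mod q num.One p"
    using assms by (cases "prod_mod q gs = mul_mod q num.One p")
      (simp_all add: checked_trie_def same_num_iff)
  then obtain L where L: "ladders q base_primes gs = Some L"
    and look: "look q t xs = ladder_look q num.One L xs"
    using assms
    by (cases "ladders q base_primes gs"; cases b)
      (auto simp: checked_trie_def same_num_iff look_expand)
  let ?S = "map (\<lambda>l. (l, a)) base_primes"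
  have "\<forall>l\<in>set base_primes. 0 < l"
    by (simp add: base_primes_def)
  then have v: "residue q (ladder_value q num.One ?S L) (1 * (\<Prod>g\<leftarrow>gs. numeral g) ^ a)"
    and fits: "ladder_fits ?S L"
    using ladders_sound[OF L _ residue_One] by blast+
  have "[(\<Prod>g\<leftarrow>gs. numeral g) = (numeral p :: int)] (mod numeral q)"
    using residue_num_cong[OF residue_prod_mod, of q gs]
      residue_num_cong[OF residue_mul[OF residue_One], of q p]
    unfolding same mult_1 by (meson cong_sym cong_trans)
  then have "[1 * (\<Prod>g\<leftarrow>gs. numeral g) ^ a = (numeral p :: int) ^ a] (mod numeral q)"
    unfolding mult_1 by (rule cong_pow)
  then have "residue q (ladder_value q num.One ?S L) (numeral p ^ a)"
    by (rule residue_cong[OF v])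
  then show "\<exists>v ys. (v, ys) \<in> set (look q t xs) \<and> residue q v (numeral p ^ a) \<and> class_match ys a"
    using ladder_look_complete[OF fits, of xs q num.One] xs unfolding look class_match_def by blast
qed

lemma decomposed_trie_sound: "decomposed_trie q p c = Some t \<Longrightarrow> trie_sound m q p t"
  by (cases "(q, p, c)" rule: decomposed_trie.cases) (auto intro: checked_trie_sound)

section \<open>Sieving exponent classes\<close>

fun singles :: "(num \<times> 'a) list \<Rightarrow> (num \<times> 'a list) list" where
  "singles [] = []"
| "singles ((v, y) # r) = (v, [y]) # singles r"

fun negate_all :: "num \<Rightarrow> (num \<times> 'a) list \<Rightarrow> (num \<times> 'a) list" where
  "negate_all q [] = []"
| "negate_all q ((v, y) # r) = (neg_mod q v, y) # negate_all q r"

fun add_each ::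
    "num \<Rightarrow> num \<Rightarrow> 'a \<Rightarrow> (num \<times> 'a list) list \<Rightarrow> (num \<times> 'a list) list \<Rightarrow> (num \<times> 'a list) list" where
  "add_each q v y [] acc = acc"
| "add_each q v y ((w, ys) # r) acc = (add_mod q v w, y # ys) # add_each q v y r acc"

fun combine :: "num \<Rightarrow> (num \<times> 'a) list \<Rightarrow> (num \<times> 'a list) list \<Rightarrow> (num \<times> 'a list) list" where
  "combine q [] R = []"
| "combine q ((v, y) # r) R = add_each q v y R (combine q r R)"

fun left_sums :: "num \<Rightarrow> trie list \<Rightarrow> exponent_class list \<Rightarrow> (num \<times> exponent_class list) list" where
  "left_sums q [t] [x] = singles (look q t x)"
| "left_sums q (t # t' # ts) (x # xs) = combine q (look q t x) (left_sums q (t' # ts) xs)"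
| "left_sums q ts xs = []"

text \<open>All terms but the last are negated: the last base is the right-hand side of the
  equation, and the others have been moved across to it.\<close>

fun right_sums :: "num \<Rightarrow> trie list \<Rightarrow> exponent_class list \<Rightarrow> (num \<times> exponent_class list) list" where
  "right_sums q [t] [x] = singles (look q t x)"
| "right_sums q (t # t' # ts) (x # xs) =
     combine q (negate_all q (look q t x)) (right_sums q (t' # ts) xs)"
| "right_sums q ts xs = []"

text \<open>A binary trie on the bits of the residue, lowest bit first, so that finding all partners
  of a sum takes one walk.\<close>

datatype 'b buckets = Empty | Buckets "'b list" "'b buckets" "'b buckets"

fun insert_bucket :: "num \<Rightarrow> 'b \<Rightarrow> 'b buckets \<Rightarrow> 'b buckets" where
  "insert_bucket num.One r Empty = Buckets [r] Empty Empty"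
| "insert_bucket (num.Bit0 d) r Empty = Buckets [] (insert_bucket d r Empty) Empty"
| "insert_bucket (num.Bit1 d) r Empty = Buckets [] Empty (insert_bucket d r Empty)"
| "insert_bucket num.One r (Buckets xs a b) = Buckets (r # xs) a b"
| "insert_bucket (num.Bit0 d) r (Buckets xs a b) = Buckets xs (insert_bucket d r a) b"
| "insert_bucket (num.Bit1 d) r (Buckets xs a b) = Buckets xs a (insert_bucket d r b)"

fun find_bucket :: "num \<Rightarrow> 'b buckets \<Rightarrow> 'b list" where
  "find_bucket s Empty = []"
| "find_bucket num.One (Buckets xs a b) = xs"
| "find_bucket (num.Bit0 s) (Buckets xs a b) = find_bucket s a"
| "find_bucket (num.Bit1 s) (Buckets xs a b) = find_bucket s b"

fun bucket_all :: "(num \<times> 'b) list \<Rightarrow> 'b buckets" where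
  "bucket_all [] = Empty"
| "bucket_all ((d, r) # R) = insert_bucket d r (bucket_all R)"

fun pair_each :: "'a \<Rightarrow> 'b list \<Rightarrow> ('a \<times> 'b) list \<Rightarrow> ('a \<times> 'b) list" where
  "pair_each l [] acc = acc"
| "pair_each l (r # rs) acc = (l, r) # pair_each l rs acc"

fun match_all :: "(num \<times> 'a) list \<Rightarrow> 'b buckets \<Rightarrow> ('a \<times> 'b) list" where
  "match_all [] B = []"
| "match_all ((s, l) # L) B = pair_each l (find_bucket s B) (match_all L B)"

type_synonym candidate = "exponent_class list \<times> exponent_class list"

fun sift :: "num \<Rightarrow> trie list \<Rightarrow> trie list \<Rightarrow> candidate list \<Rightarrow> candidate list" where
  "sift q lt rt [] = []"
| "sift q lt rt ((l, r) # cs) =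
     match_all (left_sums q lt l) (bucket_all (right_sums q rt r)) @ sift q lt rt cs"

text \<open>A modulus for which some base has no trie is skipped, which keeps all candidates and
  hence loses no solution.\<close>

fun sift_if :: "num \<Rightarrow> trie list option \<Rightarrow> trie list option \<Rightarrow> candidate list \<Rightarrow> candidate list" where
  "sift_if q (Some lt) (Some rt) cs = sift q lt rt cs"
| "sift_if q None rt cs = cs"
| "sift_if q (Some lt) None cs = cs"

section \<open>Completeness of a sieving step\<close>

lemma singles_in: "(v, y) \<in> set r \<Longrightarrow> (v, [y]) \<in> set (singles r)"
  by (induction r rule: singles.induct) auto

lemma negate_all_in: "(v, y) \<in> set r \<Longrightarrow> (neg_mod q v, y) \<in> set (negate_all q r)"
  by (induction q r rule: negate_all.induct) auto

lemma add_each_in: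
  "(w, ys) \<in> set R \<Longrightarrow> (add_mod q v w, y # ys) \<in> set (add_each q v y R acc)"
  "x \<in> set acc \<Longrightarrow> x \<in> set (add_each q v y R acc)"
  by (induction q v y R acc rule: add_each.induct) auto

lemma combine_in:
  "(v, y) \<in> set r \<Longrightarrow> (w, ys) \<in> set R \<Longrightarrow> (add_mod q v w, y # ys) \<in> set (combine q r R)"
  by (induction q r R rule: combine.induct) (auto intro: add_each_in)

lemma find_bucket_insert:
  "r \<in> set (find_bucket d (insert_bucket d r B))"
  "x \<in> set (find_bucket s B) \<Longrightarrow> x \<in> set (find_bucket s (insert_bucket d r B))"
proof -
  show "r \<in> set (find_bucket d (insert_bucket d r B))"
    by (induction d r B rule: insert_bucket.induct) auto
  show "x \<in> set (find_bucket s (insert_bucket d r B))" if "x \<in> set (find_bucket s B)"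
    using that
  proof (induction d r B arbitrary: s rule: insert_bucket.induct)
    case (4 r xs a b)
    then show ?case by (cases s) auto
  next
    case (5 d r xs a b)
    then show ?case by (cases s) auto
  next
    case (6 d r xs a b)
    then show ?case by (cases s) auto
  qed auto
qed

lemma bucket_all_in: "(s, r) \<in> set R \<Longrightarrow> r \<in> set (find_bucket s (bucket_all R))"
  by (induction R rule: bucket_all.induct) (auto intro: find_bucket_insert)

lemma pair_each_in:
  "r \<in> set rs \<Longrightarrow> (l, r) \<in> set (pair_each l rs acc)"
  "x \<in> set acc \<Longrightarrow> x \<in> set (pair_each l rs acc)"
  by (induction l rs acc rule: pair_each.induct) auto

lemma match_all_in:
  "(s, l) \<in> set L \<Longrightarrow> (s, r) \<in> set R \<Longrightarrow> (l, r) \<in> set (match_all L (bucket_all R))"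
  by (induction L "bucket_all R" rule: match_all.induct) (auto intro: pair_each_in bucket_all_in)

lemma sift_in:
  "(l, r) \<in> set cs \<Longrightarrow> x \<in> set (match_all (left_sums q lt l) (bucket_all (right_sums q rt r))) \<Longrightarrow>
   x \<in> set (sift q lt rt cs)"
  by (induction q lt rt cs rule: sift.induct) auto

fun left_value :: "num list \<Rightarrow> nat list \<Rightarrow> int" where
  "left_value [p] [a] = numeral p ^ a"
| "left_value (p # p' # ps) (a # as) = numeral p ^ a + left_value (p' # ps) as"
| "left_value ps as = 0"

fun right_value :: "num list \<Rightarrow> nat list \<Rightarrow> int" where
  "right_value [p] [a] = numeral p ^ a"
| "right_value (p # p' # ps) (a # as) = - (numeral p ^ a) + right_value (p' # ps) as"
| "right_value ps as = 0"

text \<open>For each term, take the refinement that contains its actual exponent and add the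
  residues found there.\<close>

lemma left_sums_complete:
  assumes "list_all2 (trie_sound m q) ps ts" "list_all2 class_match xs as"
    "\<forall>a\<in>set as. numeral m \<le> a"
    "length as = length ps" "ps \<noteq> []"
  shows "\<exists>s ys. (s, ys) \<in> set (left_sums q ts xs) \<and> residue q s (left_value ps as) \<and>
    list_all2 class_match ys as"
  using assms
proof (induction ps as arbitrary: ts xs rule: left_value.induct)
  case (1 p a)
  then obtain t x where t: "ts = [t]" "xs = [x]" "trie_sound m q p t" "class_match x a" "numeral m \<le> a"
    by (auto simp: list_all2_Cons1 list_all2_Cons2)
  then obtain v y where "(v, y) \<in> set (look q t x)" "residue q v (numeral p ^ a)" "class_match y a"
    unfolding trie_sound_def by blast
  then show ?case
    unfolding t left_sums.simps left_value.simps using singles_in by fastforce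
next
  case (2 p p' ps a as)
  then obtain t t' ts' x xs' where t: "ts = t # t' # ts'" "xs = x # xs'" "trie_sound m q p t"
      "list_all2 (trie_sound m q) (p' # ps) (t' # ts')"
      "class_match x a" "list_all2 class_match xs' as" "numeral m \<le> a"
    by (auto simp: list_all2_Cons1 list_all2_Cons2)
  then obtain v y where v: "(v, y) \<in> set (look q t x)" "residue q v (numeral p ^ a)" "class_match y a"
    unfolding trie_sound_def by blast
  obtain s ys where s: "(s, ys) \<in> set (left_sums q (t' # ts') xs')"
      "residue q s (left_value (p' # ps) as)"
      "list_all2 class_match ys as"
    using "2.IH"[OF t(4,6)] "2.prems" by auto
  show ?case
    unfolding t left_sums.simps left_value.simps
    using combine_in[OF v(1) s(1)] residue_add[OF v(2) s(2)] v(3) s(3) by blast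
qed auto

lemma right_sums_complete:
  assumes "list_all2 (trie_sound m q) ps ts" "list_all2 class_match xs as"
    "\<forall>a\<in>set as. numeral m \<le> a"
    "length as = length ps" "ps \<noteq> []"
  shows "\<exists>s ys. (s, ys) \<in> set (right_sums q ts xs) \<and> residue q s (right_value ps as) \<and>
    list_all2 class_match ys as"
  using assms
proof (induction ps as arbitrary: ts xs rule: right_value.induct)
  case (1 p a)
  then obtain t x where t: "ts = [t]" "xs = [x]" "trie_sound m q p t" "class_match x a" "numeral m \<le> a"
    by (auto simp: list_all2_Cons1 list_all2_Cons2)
  then obtain v y where "(v, y) \<in> set (look q t x)" "residue q v (numeral p ^ a)" "class_match y a"
    unfolding trie_sound_def by blast
  then show ?case
    unfolding t right_sums.simps right_value.simps using singles_in by fastforce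
next
  case (2 p p' ps a as)
  then obtain t t' ts' x xs' where t: "ts = t # t' # ts'" "xs = x # xs'" "trie_sound m q p t"
      "list_all2 (trie_sound m q) (p' # ps) (t' # ts')"
      "class_match x a" "list_all2 class_match xs' as" "numeral m \<le> a"
    by (auto simp: list_all2_Cons1 list_all2_Cons2)
  then obtain v y where v: "(v, y) \<in> set (look q t x)" "residue q v (numeral p ^ a)" "class_match y a"
    unfolding trie_sound_def by blast
  obtain s ys where s: "(s, ys) \<in> set (right_sums q (t' # ts') xs')"
      "residue q s (right_value (p' # ps) as)"
      "list_all2 class_match ys as"
    using "2.IH"[OF t(4,6)] "2.prems" by auto
  show ?case
    unfolding t right_sums.simps right_value.simps
    using combine_in[OF negate_all_in[OF v(1)] s(1)] residue_add[OF residue_neg[OF v(2)] s(2)] v(3) s(3)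
    by blast
qed auto

text \<open>For each modulus, \<open>True\<close> if its tries are worth multiplying out, and the exponents \<open>e\<close> for
  which \<open>p ^ e\<close> is the factor of \<open>l\<close>-power order of \<open>p\<close>: modulo the exponent of the group generated by
  the primes up to 19, \<open>e\<close> is 1 on the \<open>l\<close>-part and 0 on the rest.\<close>

definition moduli :: "(num \<times> bool \<times> num list) list" where
  "moduli = map (\<lambda>(q, b, es). (num_of_nat q, b, map num_of_nat es))
   [    (2, True, []), (3, True, [1]), (5, True, [1]), (7, True, [3, 4]), (8, True, [1]),
    (9, True, [3, 4]), (11, True, [5, 10, 6]), (13, True, [9, 4]), (16, True, [1]),
    (17, True, [1]), (19, True, [9, 10]), (23, True, [11, 22, 22, 22, 12]),
    (25, True, [5, 20, 16]), (27, True, [9, 10]), (31, True, [15, 10, 6]), (32, True, [1]),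
    (37, True, [9, 28]), (41, True, [25, 40, 16]), (61, True, [45, 40, 36]), (64, True, [1]),
    (67, True, [33, 22, 66, 66, 12]), (73, True, [9, 64]), (81, True, [27, 28]),
    (97, True, [33, 64]), (101, False, [25, 100, 76]), (109, True, [81, 28]),
    (121, False, [55, 110, 66, 110, 100]), (125, True, [25, 100, 76]), (128, True, [1]),
    (151, True, [75, 100, 126]), (157, True, [117, 52, 156, 156, 156, 144]),
    (163, True, [81, 82]), (169, False, [117, 52, 156, 156, 156, 144]),
    (181, True, [45, 100, 36]), (193, True, [129, 64]), (241, False, [225, 160, 96]),
    (243, True, [81, 82]), (251, False, [125, 250, 126]), (256, True, [1]), (257, False, [1]),
    (271, False, [135, 190, 216]), (397, False, [297, 352, 396, 396, 144]),
    (401, False, [225, 400, 176]), (433, True, [81, 352]), (487, True, [243, 244]),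
    (512, False, [1]), (541, False, [405, 460, 216]), (577, False, [513, 64]),
    (601, False, [225, 400, 576]), (625, False, [125, 500, 376]),
    (641, False, [385, 640, 256]), (729, False, [243, 244]), (751, False, [375, 250, 126]),
    (769, False, [513, 256]), (811, False, [405, 730, 486]),
    (937, False, [585, 208, 936, 936, 936, 144]), (1024, False, [1]),
    (1297, False, [81, 1216]), (1459, False, [729, 730]), (2048, False, [1]),
    (2187, False, [729, 730]), (2377, False, [297, 352, 2376, 2376, 1728]),
    (2917, False, [729, 2188]), (23041, False, [18945, 17920, 9216])]"

text \<open>Stays folded during the search, where the evaluated tables rewrite it. It is
  \<open>None\<close> if \<open>p\<close> divides \<open>q\<close>: then the product check fails or
  a ladder never reaches 1.\<close>

definition power_table :: "num \<Rightarrow> num \<Rightarrow> trie option" where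
  "power_table q p = decomposed_trie q p (map_of moduli q)"

fun tabulated :: "num \<Rightarrow> bool \<times> num list \<Rightarrow> num list \<Rightarrow> bool" where
  "tabulated q c [] \<longleftrightarrow> True"
| "tabulated q c (p # ps) \<longleftrightarrow> power_table q p = decomposed_trie q p (Some c) \<and> tabulated q c ps"

fun all_tabulated :: "(num \<times> bool \<times> num list) list \<Rightarrow> num list \<Rightarrow> bool" where
  "all_tabulated [] ps \<longleftrightarrow> True"
| "all_tabulated ((q, c) # ms) ps \<longleftrightarrow> tabulated q c ps \<and> all_tabulated ms ps"

lemma num_of_nat_eval: "num_of_nat (numeral n) = n" "num_of_nat 1 = num.One"
  by (simp_all add: num_of_nat_numeral_eq num_of_nat_One)

lemmas moduli_eval = moduli_def[unfolded list.map prod.case num_of_nat_eval]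

lemma distinct_moduli: "distinct (map fst moduli)"
  by (simp add: moduli_eval)

lemma tabulated_if_member: "map_of moduli q = Some c \<Longrightarrow> tabulated q c ps"
  by (induction ps) (simp_all add: power_table_def)

text \<open>True by definition of \<open>power_table\<close>, as distinct moduli make
  \<open>map_of\<close> return each listed entry. Its instance at \<open>moduli\<close> itself
  simplifies to explicit tables.\<close>

lemma all_tabulated_subset: "set ms \<subseteq> set moduli \<Longrightarrow> all_tabulated ms ps"
  by (induction ms ps rule: all_tabulated.induct)
    (auto intro: tabulated_if_member map_of_is_SomeI distinct_moduli)

lemma append_eval: "[] @ ys = ys" "(x # xs) @ ys = x # (xs @ ys)"
  by simp_all

text \<open>Successor form, as the table functions recurse through \<open>Suc\<close>.\<close>

lemma nat_eval:
  "base_primes = [Suc (Suc 0), Suc (Suc (Suc 0)), Suc (Suc (Suc (Suc (Suc 0)))),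
     Suc (Suc (Suc (Suc (Suc (Suc (Suc 0)))))),
     Suc (Suc (Suc (Suc (Suc (Suc (Suc (Suc (Suc (Suc (Suc 0)))))))))),
     Suc (Suc (Suc (Suc (Suc (Suc (Suc (Suc (Suc (Suc (Suc (Suc (Suc 0))))))))))))]"
  "ladder_height = Suc (Suc (Suc (Suc (Suc (Suc (Suc (Suc (Suc (Suc (Suc (Suc 0)))))))))))"
  by (simp_all add: base_primes_def ladder_height_def)

lemmas table_eval =
  arith_eval append_eval nat_eval cons_option.simps append_option.simps powers_from.simps
  nat_power_mod.simps ladder.simps ladders.simps expand_eval prod_mod.simps to_trie.simps guard.simps
  powers_mod.simps checked_trie_def decomposed_trie.simps tabulated.simps all_tabulated.simps

text \<open>All functions are evaluated by rewriting with their equations, hence the auxiliary functions that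
  dispatch on constructors instead of using \<open>if\<close> and \<open>case\<close>. The tables are evaluated once here and
  serve as rewrite rules later.\<close>

lemmas power_tables =
  all_tabulated_subset[OF subset_refl, of "map num_of_nat [2, 3, 5, 7, 11, 13, 17, 19]",
    simplified moduli_eval list.map num_of_nat_eval table_eval simp_thms]

text \<open>All exponents are at least \<open>m\<close>, so a base \<open>p\<close> contributes 0 modulo every divisor of \<open>p ^ m\<close>.
  This is what separates the exponents in question from those of genuine small solutions.\<close>

fun zero_trie :: "bool \<Rightarrow> num \<Rightarrow> trie option" where
  "zero_trie True q = Some (Leaf q)"
| "zero_trie False q = None"

fun trie_or_zero :: "num \<Rightarrow> num \<Rightarrow> num \<Rightarrow> trie option \<Rightarrow> trie option" where
  "trie_or_zero m q p (Some t) = Some t"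
| "trie_or_zero m q p None = zero_trie (same_num (power_mod q p m) q) q"

text \<open>Base 1 is constantly 1 and needs no table; it encodes zero exponents and, when repeated,
  constants.\<close>

fun term_trie :: "num \<Rightarrow> num \<Rightarrow> num \<Rightarrow> trie option" where
  "term_trie m q num.One = Some (Leaf num.One)"
| "term_trie m q (num.Bit0 p) = trie_or_zero m q (num.Bit0 p) (power_table q (num.Bit0 p))"
| "term_trie m q (num.Bit1 p) = trie_or_zero m q (num.Bit1 p) (power_table q (num.Bit1 p))"

fun cons_if_defined :: "'a option \<Rightarrow> 'a list option \<Rightarrow> 'a list option" where
  "cons_if_defined None ys = None"
| "cons_if_defined (Some x) None = None"
| "cons_if_defined (Some x) (Some ys) = Some (x # ys)"

fun term_tries :: "num \<Rightarrow> num \<Rightarrow> num list \<Rightarrow> trie list option" where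
  "term_tries m q [] = Some []"
| "term_tries m q (p # ps) = cons_if_defined (term_trie m q p) (term_tries m q ps)"

text \<open>Stops once no candidate is left, so that the remaining moduli are not evaluated.\<close>

fun sieve :: "num \<Rightarrow> num list \<Rightarrow> num list \<Rightarrow> num list \<Rightarrow> candidate list \<Rightarrow> candidate list" where
  "sieve m lp rp [] cs = cs"
| "sieve m lp rp (q # qs) [] = []"
| "sieve m lp rp (q # qs) (c # cs) =
     sieve m lp rp qs (sift_if q (term_tries m q lp) (term_tries m q rp) (c # cs))"

fun unconstrained :: "num list \<Rightarrow> exponent_class list" where
  "unconstrained [] = []"
| "unconstrained (p # ps) = [] # unconstrained ps"

fun is_empty :: "'a list \<Rightarrow> bool" where
  "is_empty [] \<longleftrightarrow> True"
| "is_empty (x # xs) \<longleftrightarrow> False"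

definition refutes :: "num \<Rightarrow> num list \<Rightarrow> num list \<Rightarrow> num list \<Rightarrow> bool" where
  "refutes m lp rp qs \<longleftrightarrow> is_empty (sieve m lp rp qs [(unconstrained lp, unconstrained rp)])"

text \<open>As \<open>q\<close> represents 0, the test says that \<open>q\<close> divides
  \<open>p ^ m\<close>, hence also \<open>p ^ a\<close> for every larger \<open>a\<close>.\<close>

lemma trie_sound_zero:
  assumes "same_num (power_mod q p m) q"
  shows "trie_sound m q p (Leaf q)"
  unfolding trie_sound_def
proof (intro allI impI)
  fix a xs
  assume a: "numeral m \<le> a" and xs: "class_match xs a"
  have "[(numeral q :: int) = numeral p ^ numeral m] (mod numeral q)"
    using residue_num_cong[OF residue_power, of q p m] assms by (simp only: same_num_iff)
  then have "[numeral q * numeral p ^ (a - numeral m) =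
      (numeral p ^ numeral m * numeral p ^ (a - numeral m) :: int)] (mod numeral q)"
    by (rule cong_mult[OF _ cong_refl])
  moreover have "[(numeral q :: int) = numeral q * numeral p ^ (a - numeral m)] (mod numeral q)"
    by (simp only: cong_def mod_mult_self1_is_0 mod_self)
  ultimately have "[(numeral q :: int) = numeral p ^ numeral m * numeral p ^ (a - numeral m)]
      (mod numeral q)"
    by (rule cong_trans[rotated])
  then have "residue q q (numeral p ^ a)"
    using a by (intro residueI order_refl) (simp only: power_add[symmetric] le_add_diff_inverse)
  then show "\<exists>v ys. (v, ys) \<in> set (look q (Leaf q) xs) \<and>
      residue q v (numeral p ^ a) \<and> class_match ys a"
    using xs by auto
qed

lemma trie_or_zero_sound:
  assumes "trie_or_zero m q p (power_table q p) = Some t"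
  shows "trie_sound m q p t"
proof (cases "power_table q p")
  case None
  then show ?thesis
    using assms trie_sound_zero by (cases "same_num (power_mod q p m) q") auto
next
  case (Some u)
  then show ?thesis
    using assms decomposed_trie_sound by (simp add: power_table_def)
qed

lemma term_trie_sound: "term_trie m q p = Some t \<Longrightarrow> trie_sound m q p t"
  using trie_or_zero_sound[of m q p t] residue_One[of q]
  by (cases p) (auto simp: trie_sound_def)

lemma term_tries_sound: "term_tries m q ps = Some ts \<Longrightarrow> list_all2 (trie_sound m q) ps ts"
proof (induction ps arbitrary: ts)
  case (Cons p ps)
  then show ?case
    by (cases "term_tries m q ps") (auto elim!: cons_if_defined.elims dest: term_trie_sound)
qed simp

text \<open>For an actual solution both half sums have the same residue; representatives are unique,
  so the halves meet in one bucket.\<close>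

lemma sift_if_complete:
  assumes "(l, r) \<in> set cs" "list_all2 class_match l as" "list_all2 class_match r bs"
    and "\<forall>a\<in>set as \<union> set bs. numeral m \<le> a" "length as = length lp" "length bs = length rp"
    and "lp \<noteq> []" "rp \<noteq> []" "left_value lp as = right_value rp bs"
  shows "\<exists>l r. (l, r) \<in> set (sift_if q (term_tries m q lp) (term_tries m q rp) cs) \<and>
    list_all2 class_match l as \<and> list_all2 class_match r bs"
proof (cases "term_tries m q lp = None \<or> term_tries m q rp = None")
  case True
  then show ?thesis
    using assms(1-3) by (cases "term_tries m q lp") auto
next
  case False
  then obtain lt rt where t: "term_tries m q lp = Some lt" "term_tries m q rp = Some rt"
    by auto
  obtain s l' where s: "(s, l') \<in> set (left_sums q lt l)" "residue q s (left_value lp as)"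
      "list_all2 class_match l' as"
    using left_sums_complete[OF term_tries_sound[OF t(1)] assms(2)] assms by blast
  obtain s' r' where s': "(s', r') \<in> set (right_sums q rt r)" "residue q s' (right_value rp bs)"
      "list_all2 class_match r' bs"
    using right_sums_complete[OF term_tries_sound[OF t(2)] assms(3)] assms by blast
  have "s = s'"
    using residue_unique[OF s(2) s'(2)] assms(9) by simp
  then have "(l', r') \<in> set (sift q lt rt cs)"
    using sift_in[OF assms(1) match_all_in[OF s(1)]] s'(1) by blast
  then show ?thesis
    using s(3) s'(3) t by auto
qed

lemma sieve_complete:
  assumes "(l, r) \<in> set cs" "list_all2 class_match l as" "list_all2 class_match r bs"
    and "\<forall>a\<in>set as \<union> set bs. numeral m \<le> a" "length as = length lp" "length bs = length rp"
    and "lp \<noteq> []" "rp \<noteq> []" "left_value lp as = right_value rp bs"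
  shows "sieve m lp rp qs cs \<noteq> []"
  using assms(1-3)
proof (induction qs arbitrary: l r cs)
  case Nil
  then show ?case by auto
next
  case (Cons q qs)
  obtain c cs' where cs: "cs = c # cs'"
    using Cons.prems(1) by (cases cs) auto
  obtain l' r' where "(l', r') \<in> set (sift_if q (term_tries m q lp) (term_tries m q rp) cs)"
    "list_all2 class_match l' as" "list_all2 class_match r' bs"
    using sift_if_complete[OF Cons.prems assms(4-9)] by blast
  then show ?case
    using Cons.IH unfolding cs sieve.simps by blast
qed

lemma unconstrained_match: "length as = length ps \<Longrightarrow> list_all2 class_match (unconstrained ps) as"
  by (induction ps as rule: list_induct2') (auto simp: class_match_def)

text \<open>A solution matches the unconstrained classes and survives every modulus, so an empty
  final list excludes it.\<close>

theorem refutes_sound: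
  assumes "refutes m lp rp qs" "lp \<noteq> []" "rp \<noteq> []" "length as = length lp" "length bs = length rp"
    and "\<forall>a\<in>set as \<union> set bs. numeral m \<le> a"
  shows "left_value lp as \<noteq> right_value rp bs"
proof
  assume "left_value lp as = right_value rp bs"
  then have "sieve m lp rp qs [(unconstrained lp, unconstrained rp)] \<noteq> []"
    using assms by (intro sieve_complete[of "unconstrained lp" "unconstrained rp"])
      (auto intro: unconstrained_match)
  then show False
    using assms(1) by (auto simp: refutes_def elim: is_empty.elims)
qed

lemmas sieve_eval =
  arith_eval append_eval list.map num_of_nat_eval cons_if_defined.simps prepend_digit.simps
  prepend_block.simps ladder_branches_eval ladder_branch_eval ladder_look_eval look.simps look_all.simps
  look_child.simps singles.simps negate_all.simps add_each.simps combine.simps left_sums.simps(1-2)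
  right_sums.simps(1-2) insert_bucket.simps find_bucket.simps bucket_all.simps
  pair_each.simps match_all.simps sift.simps sift_if.simps
  zero_trie.simps trie_or_zero.simps term_trie.simps term_tries.simps sieve.simps unconstrained.simps
  is_empty.simps refutes_def

section \<open>The search over all sets of primes\<close>

text \<open>After the common base moduli, a route continues with moduli whose unit groups refine the exponents
  by the named primes; routes through 5, 11 and 13 reach moduli \<open>p ^ k\<close> that exclude genuine
  solutions with small exponents.\<close>

datatype route = Two | Three | Five | Two_Five | Two_Powers | Two_Eleven
  | Three_Eleven | Three_Five_Eleven | Thirteen

definition base_moduli :: "num list" where
  "base_moduli = map num_of_nat [2, 3, 8, 5, 16, 13, 7, 9, 19, 37, 27, 73]"

fun tail_moduli :: "route \<Rightarrow> num list" where
  "tail_moduli Two = map num_of_nat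
     [17, 32, 64, 97, 193, 577, 128, 256, 257, 512, 769, 1024]"
| "tail_moduli Three = map num_of_nat
     [109, 81, 433, 163, 17, 32, 243, 487, 1297, 729, 1459, 2187, 2917]"
| "tail_moduli Five = map num_of_nat
     [181, 31, 61, 11, 25]"
| "tail_moduli Two_Five = map num_of_nat
     [17, 32, 64, 97, 193, 31, 61, 11, 25, 181, 241, 41, 101, 151, 251, 601, 125, 401, 625, 751]"
| "tail_moduli Two_Powers = map num_of_nat
     [17, 32, 64, 97, 193, 31, 61, 11, 25, 181, 241, 41, 257, 512, 769, 641, 1024, 2048, 23041]"
| "tail_moduli Two_Eleven = map num_of_nat
     [17, 32, 64, 97, 193, 31, 61, 11, 25, 181, 241, 41, 257, 256, 397, 23, 67, 121]"
| "tail_moduli Three_Eleven = map num_of_nat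
     [109, 81, 433, 163, 17, 32, 31, 61, 11, 25, 181, 2377, 67, 23, 121]"
| "tail_moduli Three_Five_Eleven = map num_of_nat
     [109, 81, 433, 163, 17, 32, 243, 487, 31, 61, 11, 25, 181, 241, 271, 541, 811, 397, 23,
      67, 121]"
| "tail_moduli Thirteen = map num_of_nat
     [17, 32, 64, 97, 193, 937, 157, 169]"

fun same_nums :: "num list \<Rightarrow> num list \<Rightarrow> bool" where
  "same_nums [] [] \<longleftrightarrow> True"
| "same_nums (x # xs) (y # ys) \<longleftrightarrow> same_num x y \<and> same_nums xs ys"
| "same_nums [] (y # ys) \<longleftrightarrow> False"
| "same_nums (x # xs) [] \<longleftrightarrow> False"

fun choose_route :: "bool \<Rightarrow> route \<Rightarrow> route \<Rightarrow> route" where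
  "choose_route True a b = a"
| "choose_route False a b = b"

fun find_route :: "num list \<Rightarrow> (nat list \<times> route) list \<Rightarrow> route" where
  "find_route S [] = Two"
| "find_route S ((k, a) # rs) = choose_route (same_nums S (map num_of_nat k)) a (find_route S rs)"

text \<open>The terms are split into halves of nearly equal size, with \<open>r\<close> last on the
  right. Lengths 2 to 5 correspond to t from 3 to 6; other lengths are vacuous.\<close>

fun refuted :: "(nat list \<times> route) list \<Rightarrow> num \<Rightarrow> num list \<Rightarrow> bool" where
  "refuted rs r [] \<longleftrightarrow> True"
| "refuted rs r [a] \<longleftrightarrow> True"
| "refuted rs r [a, b] \<longleftrightarrow>
     refutes (num_of_nat 16) [a] [b, r] (base_moduli @ tail_moduli (find_route [a, b] rs))"
| "refuted rs r [a, b, c] \<longleftrightarrow>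
     refutes (num_of_nat 16) [a, b] [c, r] (base_moduli @ tail_moduli (find_route [a, b, c] rs))"
| "refuted rs r [a, b, c, d] \<longleftrightarrow>
     refutes (num_of_nat 16) [a, b] [c, d, r]
       (base_moduli @ tail_moduli (find_route [a, b, c, d] rs))"
| "refuted rs r [a, b, c, d, e] \<longleftrightarrow>
     refutes (num_of_nat 16) [a, b, c] [d, e, r]
       (base_moduli @ tail_moduli (find_route [a, b, c, d, e] rs))"
| "refuted rs r (a # b # c # d # e # f # S) \<longleftrightarrow> True"

text \<open>Each prime in turn is left out or taken, so the leaves run through all sublists.\<close>

fun explore :: "(nat list \<times> route) list \<Rightarrow> num \<Rightarrow> num list \<Rightarrow> num list \<Rightarrow> bool" where
  "explore rs r S [] \<longleftrightarrow> refuted rs r S"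
| "explore rs r S (p # ps) \<longleftrightarrow> explore rs r S ps \<and> explore rs r (S @ [p]) ps"

lemmas search_eval =
  sieve_eval same_nums.simps choose_route.simps find_route.simps refuted.simps explore.simps
  base_moduli_def tail_moduli.simps simp_thms

text \<open>The right-hand prime is 2; the seven lemmas after it treat the others. The list assigns
  routes to particular sets of left-hand primes, and all further sets take
  \<open>Two\<close>.\<close>

lemma explore_2:
  "explore
     [([3, 5], Three), ([3, 5, 7, 11], Two_Five), ([3, 5, 11, 13], Three_Eleven),
      ([3, 5, 11, 17], Three_Eleven), ([3, 5, 11, 19], Three_Five_Eleven),
      ([3, 5, 13, 17], Thirteen), ([3, 5, 13, 19], Thirteen), ([3, 5, 17, 19], Five),
      ([3, 7, 11, 13], Three), ([3, 7, 11, 19], Three), ([3, 7, 13, 17], Three),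
      ([5, 7, 13, 17], Five), ([7, 11, 13, 19], Thirteen)]
     (num_of_nat 2) [] (map num_of_nat [3, 5, 7, 11, 13, 17, 19])"
  by (simp only: search_eval power_tables)

lemma explore_3:
  "explore
     [([2, 17], Three), ([5, 7, 13], Three), ([5, 7, 19], Three), ([5, 11, 17], Three),
      ([7, 11, 19], Three), ([7, 13, 19], Three), ([2, 5, 7, 11], Two_Eleven),
      ([2, 5, 11, 13], Two_Five), ([2, 5, 13, 19], Two_Five), ([2, 5, 17, 19], Five),
      ([5, 7, 11, 13, 19], Three), ([5, 7, 11, 17, 19], Three), ([5, 7, 13, 17, 19], Three),
      ([5, 11, 13, 17, 19], Three), ([7, 11, 13, 17, 19], Three)]
     (num_of_nat 3) [] (map num_of_nat [2, 5, 7, 11, 13, 17, 19])"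
  by (simp only: search_eval power_tables)

lemma explore_5:
  "explore
     [([7, 11, 17], Five), ([2, 3, 7, 17], Three), ([2, 3, 13, 19], Three),
      ([2, 7, 11, 19], Five), ([3, 7, 11, 13, 19], Three_Five_Eleven),
      ([3, 7, 11, 17, 19], Three), ([3, 7, 13, 17, 19], Three), ([3, 11, 13, 17, 19], Three),
      ([7, 11, 13, 17, 19], Three)]
     (num_of_nat 5) [] (map num_of_nat [2, 3, 7, 11, 13, 17, 19])"
  by (simp only: search_eval power_tables)

lemma explore_7:
  "explore
     [([3, 5, 17], Three), ([5, 11, 13], Two_Five), ([13, 17, 19], Thirteen),
      ([2, 3, 11, 13], Three), ([2, 3, 11, 19], Three), ([2, 3, 13, 19], Three),
      ([2, 5, 13, 19], Three), ([2, 5, 17, 19], Three), ([2, 11, 13, 17], Thirteen),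
      ([3, 5, 11, 13, 17], Three_Eleven), ([3, 5, 11, 13, 19], Two_Five),
      ([3, 5, 11, 17, 19], Three), ([3, 5, 13, 17, 19], Three), ([3, 11, 13, 17, 19], Three)]
     (num_of_nat 7) [] (map num_of_nat [2, 3, 5, 11, 13, 17, 19])"
  by (simp only: search_eval power_tables)

lemma explore_11:
  "explore
     [([2, 5, 13, 17], Five), ([3, 5, 7, 17, 19], Three), ([3, 5, 13, 17, 19], Three),
      ([3, 7, 13, 17, 19], Three), ([5, 7, 13, 17, 19], Three)]
     (num_of_nat 11) [] (map num_of_nat [2, 3, 5, 7, 13, 17, 19])"
  by (simp only: search_eval power_tables)

lemma explore_13:
  "explore
     [([3, 5, 17], Three), ([5, 7, 11], Two_Five), ([2, 3, 5, 17], Three),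
      ([2, 3, 7, 19], Three), ([2, 3, 11, 17], Three), ([2, 3, 17, 19], Three),
      ([2, 5, 7, 17], Two_Five), ([2, 5, 17, 19], Five), ([3, 5, 7, 11, 19], Three),
      ([3, 5, 7, 17, 19], Five), ([3, 5, 11, 17, 19], Three), ([3, 7, 11, 17, 19], Three),
      ([5, 7, 11, 17, 19], Five)]
     (num_of_nat 13) [] (map num_of_nat [2, 3, 5, 7, 11, 17, 19])"
  by (simp only: search_eval power_tables)

lemma explore_17:
  "explore
     [([2, 5, 7, 11], Five), ([2, 11, 13, 19], Two_Powers), ([3, 5, 7, 11, 13], Three),
      ([3, 5, 7, 11, 19], Three), ([3, 5, 7, 13, 19], Three), ([3, 5, 11, 13, 19], Three),
      ([3, 7, 11, 13, 19], Three)]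
     (num_of_nat 17) [] (map num_of_nat [2, 3, 5, 7, 11, 13, 19])"
  by (simp only: search_eval power_tables)

lemma explore_19:
  "explore
     [([5, 7, 13], Five), ([5, 11, 13], Five), ([7, 11, 17], Two_Five), ([2, 3, 5, 7], Five),
      ([2, 3, 7, 17], Three), ([2, 3, 13, 17], Three), ([3, 5, 7, 11, 13], Three),
      ([3, 5, 7, 11, 17], Three), ([3, 5, 7, 13, 17], Three), ([3, 5, 11, 13, 17], Three),
      ([5, 7, 11, 13, 17], Five)]
     (num_of_nat 19) [] (map num_of_nat [2, 3, 5, 7, 11, 13, 17])"
  by (simp only: search_eval power_tables)

section \<open>From the search to arbitrary sets of primes\<close>

lemma explore_filter: "explore rs r S ps \<Longrightarrow> refuted rs r (S @ filter P ps)"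
proof (induction ps arbitrary: S)
  case (Cons p ps)
  then have "refuted rs r (S @ filter P ps)" "refuted rs r (S @ p # filter P ps)"
    using Cons.IH[of "S @ [p]"] by simp_all
  then show ?case
    by simp
qed simp

text \<open>Exponents are attached to primes instead of positions, because the search orders the
  terms in its own way.\<close>

lemma refuted_no_solution:
  assumes "refuted rs r S" "2 \<le> length S" "length S \<le> 5" "\<forall>p\<in>set (r # S). 16 \<le> e p"
  shows "(\<Sum>p\<leftarrow>S. numeral p ^ e p) \<noteq> (numeral r ^ e r :: int)"
proof -
  have no: "left_value lp (map e lp) \<noteq> right_value rp (map e rp)"
    if "refutes (num_of_nat 16) lp rp qs" "lp \<noteq> []" "rp \<noteq> []"
      "set lp \<union> set rp \<subseteq> set (r # S)" for lp rp qs
    by (rule refutes_sound[OF that(1-3)]) (use that(4) assms(4) in \<open>auto simp: num_of_nat_eval\<close>)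
  show ?thesis
  proof (cases "(rs, r, S)" rule: refuted.cases)
    case (3 rs r a b)
    then show ?thesis
      using no[of "[a]" "[b, r]"] assms(1) by (simp add: algebra_simps)
  next
    case (4 rs r a b c)
    then show ?thesis
      using no[of "[a, b]" "[c, r]"] assms(1) by (simp add: algebra_simps)
  next
    case (5 rs r a b c d)
    then show ?thesis
      using no[of "[a, b]" "[c, d, r]"] assms(1) by (simp add: algebra_simps)
  next
    case (6 rs r a b c d e)
    then show ?thesis
      using no[of "[a, b, c]" "[d, e, r]"] assms(1) by (simp add: algebra_simps)
  qed (use assms in auto)
qed

definition primes_upto_19 :: "num set" where
  "primes_upto_19 = num_of_nat ` {2, 3, 5, 7, 11, 13, 17, 19}"

lemma prime_le_19: "prime p \<Longrightarrow> p \<le> 19 \<Longrightarrow> p \<in> {2, 3, 5, 7, 11, 13, 17, 19 :: nat}"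
proof -
  assume p: "prime p" "p \<le> 19"
  have "p \<in> set [0..<20]"
    using p(2) by simp
  moreover have "[0..<20] =
      [0, 1, 2, 3, 4, 5, 6, 7, 8, 9, 10, 11, 12, 13, 14, 15, 16, 17, 18, 19 :: nat]"
    by (simp add: upt_rec)
  ultimately show ?thesis
    using p(1) by auto
qed

lemma explored:
  assumes "r \<in> primes_upto_19"
  shows "\<exists>rs ps. explore rs r [] ps \<and> distinct ps \<and> set ps = primes_upto_19 - {r}"
proof -
  have *: "?thesis" if "explore rs r [] (map num_of_nat ps)" "distinct (map num_of_nat ps)"
      "set (map num_of_nat ps) = primes_upto_19 - {r}" for rs ps
    using that by blast
  consider "r = num_of_nat 2" | "r = num_of_nat 3" | "r = num_of_nat 5" | "r = num_of_nat 7"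
    | "r = num_of_nat 11" | "r = num_of_nat 13" | "r = num_of_nat 17" | "r = num_of_nat 19"
    using assms unfolding primes_upto_19_def by blast
  then show ?thesis
  proof cases
    case 1 then show ?thesis
      by (intro *[OF explore_2[folded 1]]) (auto simp: primes_upto_19_def num_of_nat_eval)
  next
    case 2 then show ?thesis
      by (intro *[OF explore_3[folded 2]]) (auto simp: primes_upto_19_def num_of_nat_eval)
  next
    case 3 then show ?thesis
      by (intro *[OF explore_5[folded 3]]) (auto simp: primes_upto_19_def num_of_nat_eval)
  next
    case 4 then show ?thesis
      by (intro *[OF explore_7[folded 4]]) (auto simp: primes_upto_19_def num_of_nat_eval)
  next
    case 5 then show ?thesis
      by (intro *[OF explore_11[folded 5]]) (auto simp: primes_upto_19_def num_of_nat_eval)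
  next
    case 6 then show ?thesis
      by (intro *[OF explore_13[folded 6]]) (auto simp: primes_upto_19_def num_of_nat_eval)
  next
    case 7 then show ?thesis
      by (intro *[OF explore_17[folded 7]]) (auto simp: primes_upto_19_def num_of_nat_eval)
  next
    case 8 then show ?thesis
      by (intro *[OF explore_19[folded 8]]) (auto simp: primes_upto_19_def num_of_nat_eval)
  qed
qed

lemma numeral_num_of_nat: "0 < n \<Longrightarrow> (numeral (num_of_nat n) :: nat) = n"
  using num_of_nat_inverse[of n] by (simp only: nat_of_num_numeral)

lemma no_solution_with_large_exponents:
  fixes p \<alpha> :: "nat \<Rightarrow> nat"
  assumes t: "3 \<le> t" "t \<le> 6" and inj: "inj_on p {1..t}"
    and primes: "\<And>i. i \<in> {1..t} \<Longrightarrow> prime (p i) \<and> p i \<le> 19"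
    and large: "\<And>i. i \<in> {1..t} \<Longrightarrow> 16 \<le> \<alpha> i"
  shows "(\<Sum>i=1..t-1. int (p i) ^ \<alpha> i) \<noteq> int (p t) ^ \<alpha> t"
proof -
  define f where "f i = num_of_nat (p i)" for i
  have f: "(numeral (f i) :: nat) = p i" if "i \<in> {1..t}" for i
    using primes[OF that] unfolding f_def by (intro numeral_num_of_nat prime_gt_0_nat) simp
  have f_int: "(numeral (f i) :: int) = int (p i)" if "i \<in> {1..t}" for i
    using f[OF that] by (metis of_nat_numeral)
  have inj_f: "inj_on f {1..t}"
    using inj f by (metis inj_on_def)
  \<comment> \<open>Injectivity of \<open>f\<close> lets each prime carry the exponent of its unique
    index.\<close>
  define e where "e n = \<alpha> (inv_into {1..t} f n)" for n
  have e: "e (f i) = \<alpha> i" if "i \<in> {1..t}" for i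
    using inv_into_f_f[OF inj_f that] by (simp add: e_def)
  have f_in: "f i \<in> primes_upto_19" if "i \<in> {1..t}" for i
    using prime_le_19 primes[OF that] unfolding f_def primes_upto_19_def by blast
  let ?T = "{1..t-1}"
  have T: "?T \<subseteq> {1..t}" "t \<in> {1..t}" "t \<notin> ?T"
    using t by auto
  obtain rs ps where ps: "explore rs (f t) [] ps" "distinct ps" "set ps = primes_upto_19 - {f t}"
    using explored[OF f_in[OF T(2)]] by blast
  \<comment> \<open>The left-hand primes in search order, which makes them a sublist visited by
    \<open>explore\<close>.\<close>
  define xs where "xs = filter (\<lambda>n. n \<in> f ` ?T) ps"
  have refuted: "refuted rs (f t) xs"
    using explore_filter[OF ps(1)] unfolding xs_def by simp
  have "f t \<notin> f ` ?T"
    using inj_onD[OF inj_f] T by (metis imageE subsetD)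
  then have "f ` ?T \<subseteq> set ps"
    unfolding ps(3) using f_in T(1) by blast
  then have set_xs: "set xs = f ` ?T"
    unfolding xs_def set_filter by blast
  have "distinct xs"
    using ps(2) by (simp add: xs_def)
  have inj_T: "inj_on f ?T"
    using inj_f T(1) by (rule inj_on_subset)
  have "length xs = t - 1"
    using distinct_card[OF \<open>distinct xs\<close>] card_image[OF inj_T] by (simp add: set_xs)
  moreover have "\<forall>n\<in>set (f t # xs). 16 \<le> e n"
    using e large T set_xs by fastforce
  ultimately have "(\<Sum>n\<leftarrow>xs. numeral n ^ e n) \<noteq> (numeral (f t) ^ e (f t) :: int)"
    using t by (intro refuted_no_solution[OF refuted]) auto
  moreover have "(\<Sum>n\<leftarrow>xs. numeral n ^ e n) = (\<Sum>i\<in>?T. int (p i) ^ \<alpha> i)"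
  proof -
    have "(\<Sum>n\<leftarrow>xs. numeral n ^ e n) = (\<Sum>n\<in>f ` ?T. numeral n ^ e n :: int)"
      using sum_list_distinct_conv_sum_set[OF \<open>distinct xs\<close>] by (simp only: set_xs)
    also have "\<dots> = (\<Sum>i\<in>?T. numeral (f i) ^ e (f i))"
      by (rule sum.reindex_cong[OF inj_T refl refl])
    also have "\<dots> = (\<Sum>i\<in>?T. int (p i) ^ \<alpha> i)"
      using T(1) by (intro sum.cong refl) (metis e f_int subsetD)
    finally show ?thesis .
  qed
  ultimately show ?thesis
    using e[OF T(2)] f_int[OF T(2)] by simp
qed

section \<open>The six-term equation\<close>

text \<open>Exponents 0 are encoded by the base 1, so that all remaining exponents are positive.\<close>

fun all_refuted :: "(nat list \<times> route) list \<Rightarrow> (nat \<times> nat \<times> nat \<times> nat \<times> nat) list \<Rightarrow> bool" where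
  "all_refuted rs [] \<longleftrightarrow> True"
| "all_refuted rs ((a, b, c, d, e) # Ss) \<longleftrightarrow>
     refutes num.One (map num_of_nat [a, b, c]) (map num_of_nat [d, e, 19])
       (base_moduli @ tail_moduli (find_route (map num_of_nat [a, b, c, d, e]) rs)) \<and>
     all_refuted rs Ss"

text \<open>These are 30 of the 32 choices of zero and positive exponents. The two absent ones, (1,
  5, 11, 1, 1) and (3, 1, 1, 13, 1), contain the solutions and cannot be refuted.\<close>

definition term_patterns :: "(nat \<times> nat \<times> nat \<times> nat \<times> nat) list" where
  "term_patterns =
     [(1, 1, 1, 1, 1), (1, 1, 1, 1, 17), (1, 1, 1, 13, 1), (1, 1, 1, 13, 17), (1, 1, 11, 1, 1),
      (1, 1, 11, 1, 17), (1, 1, 11, 13, 1), (1, 1, 11, 13, 17), (1, 5, 1, 1, 1),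
      (1, 5, 1, 1, 17), (1, 5, 1, 13, 1), (1, 5, 1, 13, 17), (1, 5, 11, 1, 17),
      (1, 5, 11, 13, 1), (1, 5, 11, 13, 17), (3, 1, 1, 1, 1), (3, 1, 1, 1, 17),
      (3, 1, 1, 13, 17), (3, 1, 11, 1, 1), (3, 1, 11, 1, 17), (3, 1, 11, 13, 1),
      (3, 1, 11, 13, 17), (3, 5, 1, 1, 1), (3, 5, 1, 1, 17), (3, 5, 1, 13, 1),
      (3, 5, 1, 13, 17), (3, 5, 11, 1, 1), (3, 5, 11, 1, 17), (3, 5, 11, 13, 1),
      (3, 5, 11, 13, 17)]"

lemma term_patterns_refuted:
  "all_refuted [([3, 1, 11, 13, 1], Five), ([3, 5, 1, 13, 17], Three), ([3, 5, 11, 13, 17], Three)]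
     term_patterns"
  by (simp only: all_refuted.simps term_patterns_def search_eval power_tables)

text \<open>Repeated bases 1 encode constants: 3 from the zero exponents, and 8, 14, 6, 16 once a
  term 5, 11, 3 or 13 with exponent 1 is added.\<close>

definition sporadic_refuted :: bool where
  "sporadic_refuted \<longleftrightarrow>
     refutes (num_of_nat 2) (map num_of_nat [1, 1, 1, 1, 1, 1, 1, 1]) (map num_of_nat [11, 19])
       (base_moduli @ tail_moduli Three_Eleven) \<and>
     refutes (num_of_nat 2) (map num_of_nat [1, 1, 1, 1, 1, 1, 1, 1, 1, 1, 1, 1, 1, 1])
       (map num_of_nat [5, 19])
       (base_moduli @ tail_moduli Five) \<and>
     refutes (num_of_nat 2) (map num_of_nat [1, 1, 1]) (map num_of_nat [5, 11, 19])
       (base_moduli @ tail_moduli Five) \<and>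
     refutes (num_of_nat 2) (map num_of_nat [1, 1, 1, 1, 1, 1]) (map num_of_nat [13, 19])
       (base_moduli @ tail_moduli Thirteen) \<and>
     refutes (num_of_nat 2) (map num_of_nat [1, 1, 1, 1, 1, 1, 1, 1, 1, 1, 1, 1, 1, 1, 1, 1])
       (map num_of_nat [3, 19])
       (base_moduli @ tail_moduli Two) \<and>
     refutes (num_of_nat 2) (map num_of_nat [1, 1, 1]) (map num_of_nat [3, 13, 19])
       (base_moduli @ tail_moduli Two)"

lemma sporadic_refuted: sporadic_refuted
  by (simp only: sporadic_refuted_def search_eval power_tables)

lemma int_numeral_num_of_nat: "0 < n \<Longrightarrow> (numeral (num_of_nat n) :: int) = int n"
  using numeral_num_of_nat[of n] by (metis of_nat_numeral)

lemma all_refuted_sound: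
  assumes "all_refuted rs Ss" "(a, b, c, d, e) \<in> set Ss"
    and pos: "0 < a" "0 < b" "0 < c" "0 < d" "0 < e"
    and exps: "1 \<le> x" "1 \<le> y" "1 \<le> z" "1 \<le> u" "1 \<le> v" "1 \<le> w"
  shows "int a ^ x + int b ^ y + int c ^ z + int d ^ u + int e ^ v \<noteq> 19 ^ w"
proof -
  have "\<exists>qs. refutes num.One (map num_of_nat [a, b, c]) (map num_of_nat [d, e, 19]) qs"
    using assms(1,2) by (induction rs Ss rule: all_refuted.induct) auto
  then obtain qs where
    "refutes num.One (map num_of_nat [a, b, c]) (map num_of_nat [d, e, 19]) qs"
    by blast
  then have "left_value (map num_of_nat [a, b, c]) [x, y, z] \<noteq>
      right_value (map num_of_nat [d, e, 19]) [u, v, w]"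
    by (rule refutes_sound) (use exps in auto)
  then show ?thesis
    using pos by (simp add: int_numeral_num_of_nat num_of_nat_eval algebra_simps)
qed

lemma sporadic_no_solution:
  assumes "2 \<le> x" "2 \<le> f"
  shows "8 + 11 ^ x \<noteq> (19 :: int) ^ f" "14 + 5 ^ x \<noteq> (19 :: int) ^ f"
    "6 + 13 ^ x \<noteq> (19 :: int) ^ f" "16 + 3 ^ x \<noteq> (19 :: int) ^ f"
    "2 \<le> y \<Longrightarrow> 3 + 5 ^ x + 11 ^ y \<noteq> (19 :: int) ^ f"
    "2 \<le> y \<Longrightarrow> 3 + 3 ^ x + 13 ^ y \<noteq> (19 :: int) ^ f"
proof -
  \<comment> \<open>The bases 1 get the dummy exponent 2, which meets the lower bound.\<close>
  have no: "left_value (map num_of_nat ps) (replicate (length ps) 2) \<noteq>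
      right_value (map num_of_nat rs) bs"
    if "refutes (num_of_nat 2) (map num_of_nat ps) (map num_of_nat rs) qs" "ps \<noteq> []" "rs \<noteq> []"
      "length bs = length rs" "\<forall>b\<in>set bs. 2 \<le> b" for ps rs qs bs
    by (rule refutes_sound[OF that(1)]) (use that in \<open>auto simp: num_of_nat_eval\<close>)
  note r = sporadic_refuted[unfolded sporadic_refuted_def]
  show "8 + 11 ^ x \<noteq> (19 :: int) ^ f"
    using no[OF r[THEN conjunct1], of "[x, f]"] assms by (simp add: num_of_nat_eval)
  show "14 + 5 ^ x \<noteq> (19 :: int) ^ f"
    using no[OF r[THEN conjunct2, THEN conjunct1], of "[x, f]"] assms by (simp add: num_of_nat_eval)
  show "3 + 5 ^ x + 11 ^ y \<noteq> (19 :: int) ^ f" if "2 \<le> y"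
    using no[OF r[THEN conjunct2, THEN conjunct2, THEN conjunct1], of "[x, y, f]"] assms that
    by (simp add: num_of_nat_eval)
  show "6 + 13 ^ x \<noteq> (19 :: int) ^ f"
    using no[OF r[THEN conjunct2, THEN conjunct2, THEN conjunct2, THEN conjunct1], of "[x, f]"] assms
    by (simp add: num_of_nat_eval)
  show "16 + 3 ^ x \<noteq> (19 :: int) ^ f"
    using no[OF r[THEN conjunct2, THEN conjunct2, THEN conjunct2, THEN conjunct2, THEN conjunct1], of "[x, f]"]
      assms by (simp add: num_of_nat_eval)
  show "3 + 3 ^ x + 13 ^ y \<noteq> (19 :: int) ^ f" if "2 \<le> y"
    using no[OF r[THEN conjunct2, THEN conjunct2, THEN conjunct2, THEN conjunct2, THEN conjunct2],
        of "[x, y, f]"]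
      assms that by (simp add: num_of_nat_eval)
qed

section \<open>The two surviving equations\<close>

lemma power_eq_19_iff: "(19 :: int) ^ f = 19 \<longleftrightarrow> f = 1"
  using power_inject_exp[of "19 :: int" f 1] by simp

lemma exponent_ge_2: "19 < (19 :: int) ^ f \<Longrightarrow> 2 \<le> f"
proof (rule ccontr)
  assume "19 < (19 :: int) ^ f" "\<not> 2 \<le> f"
  then have "f = 0 \<or> f = 1" by auto
  then show False
    using \<open>19 < (19 :: int) ^ f\<close> by auto
qed

lemma square_le_power: "2 \<le> x \<Longrightarrow> (int p) ^ 2 \<le> int p ^ x" if "0 < p"
  using that by (intro power_increasing) auto

text \<open>With both exponents 1 the sum is 19. If either is at least 2, the sum exceeds 19, so
  \<open>f\<close> is at least 2 and a sporadic refutation applies.\<close>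

lemma solution_5_11:
  assumes "3 + 5 ^ b + 11 ^ c = (19 :: int) ^ f" "0 < b" "0 < c"
  shows "b = 1 \<and> c = 1 \<and> f = 1"
proof (cases "b = 1")
  case True
  show ?thesis
  proof (cases "c = 1")
    case True
    then show ?thesis
      using assms(1) \<open>b = 1\<close> power_eq_19_iff[of f] by simp
  next
    case False
    then have c: "2 \<le> c" using assms(3) by simp
    then have "8 + 11 ^ c = (19 :: int) ^ f" "(121 :: int) \<le> 11 ^ c"
      using assms(1) True square_le_power[of 11 c] by simp_all
    then show ?thesis
      using sporadic_no_solution(1)[OF c, of f] exponent_ge_2[of f] by simp
  qed
next
  case False
  then have b: "2 \<le> b" using assms(2) by simp
  have "(25 :: int) \<le> 5 ^ b" "(0 :: int) < 11 ^ c"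
    using square_le_power[of 5 b] b by simp_all
  then have f: "2 \<le> f"
    using assms(1) by (intro exponent_ge_2) linarith
  show ?thesis
  proof (cases "c = 1")
    case True
    then show ?thesis
      using assms(1) sporadic_no_solution(2)[OF b f] by simp
  next
    case False
    then show ?thesis
      using assms sporadic_no_solution(5)[OF b f, of c] by simp
  qed
qed

lemma solution_3_13:
  assumes "3 + 3 ^ a + 13 ^ d = (19 :: int) ^ f" "0 < a" "0 < d"
  shows "a = 1 \<and> d = 1 \<and> f = 1"
proof (cases "a = 1")
  case True
  show ?thesis
  proof (cases "d = 1")
    case True
    then show ?thesis
      using assms(1) \<open>a = 1\<close> power_eq_19_iff[of f] by simp
  next
    case False
    then have d: "2 \<le> d" using assms(3) by simp
    then have "6 + 13 ^ d = (19 :: int) ^ f" "(169 :: int) \<le> 13 ^ d"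
      using assms(1) True square_le_power[of 13 d] by simp_all
    then show ?thesis
      using sporadic_no_solution(3)[OF d, of f] exponent_ge_2[of f] by simp
  qed
next
  case False
  then have a: "2 \<le> a" using assms(2) by simp
  \<comment> \<open>Here both bounds are used: 3 + 9 is still below 19, but 3 + 9 + 13 exceeds
    it.\<close>
  have "(9 :: int) \<le> 3 ^ a" "(13 :: int) \<le> 13 ^ d"
    using square_le_power[of 3 a] a assms(3) self_le_power[of "13 :: int" d] by simp_all
  then have f: "2 \<le> f"
    using assms(1) by (intro exponent_ge_2) linarith
  show ?thesis
  proof (cases "d = 1")
    case True
    then show ?thesis
      using assms(1) sporadic_no_solution(4)[OF a f] by simp
  next
    case False
    then show ?thesis
      using assms sporadic_no_solution(6)[OF a f, of d] by simp
  qed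
qed

lemma six_term_solutions:
  assumes eq: "(3 :: int) ^ a + 5 ^ b + 11 ^ c + 13 ^ d + 17 ^ e = 19 ^ f"
  shows "[a, b, c, d, e, f] \<in> {[0, 1, 1, 0, 0, 1], [1, 0, 0, 1, 0, 1]}"
proof -
  \<comment> \<open>A zero exponent becomes base 1 with exponent 1: the value is unchanged and the
    bound 1 of \<open>all_refuted\<close> is met.\<close>
  define B where "B p x = (if x = 0 then 1 else p)" for p x :: nat
  define X where "X x = (if x = 0 then 1 else x)" for x :: nat
  have BX: "int (B p x) ^ X x = int p ^ x" for p x
    by (simp add: B_def X_def)
  have X: "1 \<le> X x" for x
    by (simp add: X_def)
  have "(1 :: int) \<le> 3 ^ a" "(1 :: int) \<le> 5 ^ b" "(1 :: int) \<le> 11 ^ c"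
      "(1 :: int) \<le> 13 ^ d" "(1 :: int) \<le> 17 ^ e"
    by simp_all
  \<comment> \<open>Five terms, each at least 1, sum to at least 5.\<close>
  then have "(19 :: int) ^ f \<noteq> 1"
    using eq by linarith
  then have f: "1 \<le> f"
    by (cases f) auto
  have "(B 3 a, B 5 b, B 11 c, B 13 d, B 17 e) \<notin> set term_patterns"
  proof
    assume "(B 3 a, B 5 b, B 11 c, B 13 d, B 17 e) \<in> set term_patterns"
    then have "int (B 3 a) ^ X a + int (B 5 b) ^ X b + int (B 11 c) ^ X c + int (B 13 d) ^ X d
        + int (B 17 e) ^ X e \<noteq> 19 ^ f"
      by (intro all_refuted_sound[OF term_patterns_refuted] X f) (simp_all add: B_def)
    then show False
      using eq by (simp add: BX)
  qed
  \<comment> \<open>The two absent patterns; in each, three zero exponents contribute the constant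
    3.\<close>
  then consider "a = 0" "0 < b" "0 < c" "d = 0" "e = 0" | "0 < a" "b = 0" "c = 0" "0 < d" "e = 0"
    unfolding term_patterns_def B_def
    by (cases "a = 0"; cases "b = 0"; cases "c = 0"; cases "d = 0"; cases "e = 0") simp_all
  then show ?thesis
  proof cases
    case 1
    then have "b = 1 \<and> c = 1 \<and> f = 1"
      using eq by (intro solution_5_11) simp_all
    then show ?thesis
      using 1 by simp
  next
    case 2
    then have "a = 1 \<and> d = 1 \<and> f = 1"
      using eq by (intro solution_3_13) simp_all
    then show ?thesis
      using 2 by simp
  qed
qed

theorem theorem4:
  shows "(\<forall>(t::nat) (p::nat \<Rightarrow> nat) (\<alpha>::nat \<Rightarrow> nat).
            3 \<le> t \<and> t \<le> 6 \<and> inj_on p {1..t} \<and>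
            (\<forall>i\<in>{1..t}. prime (p i) \<and> p i \<le> 19) \<and>
            (\<Sum>i=1..t-1. int (p i) ^ \<alpha> i) - int (p t) ^ \<alpha> t = 0
            \<longrightarrow> Min (\<alpha> ` {1..t}) \<le> 15)
       \<and> {a :: nat list. length a = 6 \<and>
            (3::int) ^ (a!0) + 5 ^ (a!1) + 11 ^ (a!2) + 13 ^ (a!3) + 17 ^ (a!4) - 19 ^ (a!5) = 0}
         = {[0,1,1,0,0,1], [1,0,0,1,0,1]}"
proof (intro conjI allI impI)
  fix t :: nat and p \<alpha> :: "nat \<Rightarrow> nat"
  assume *: "3 \<le> t \<and> t \<le> 6 \<and> inj_on p {1..t} \<and> (\<forall>i\<in>{1..t}. prime (p i) \<and> p i \<le> 19) \<and>
    (\<Sum>i=1..t-1. int (p i) ^ \<alpha> i) - int (p t) ^ \<alpha> t = 0"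
  show "Min (\<alpha> ` {1..t}) \<le> 15"
  proof (rule ccontr)
    assume small: "\<not> Min (\<alpha> ` {1..t}) \<le> 15"
    have "16 \<le> \<alpha> i" if "i \<in> {1..t}" for i
    proof -
      have "Min (\<alpha> ` {1..t}) \<le> \<alpha> i"
        using that by (intro Min_le) auto
      then show ?thesis
        using small by linarith
    qed
    then have "(\<Sum>i=1..t-1. int (p i) ^ \<alpha> i) \<noteq> int (p t) ^ \<alpha> t"
      using * by (intro no_solution_with_large_exponents) blast+
    then show False
      using * by simp
  qed
next
  show "{a :: nat list. length a = 6 \<and>
      (3::int) ^ (a!0) + 5 ^ (a!1) + 11 ^ (a!2) + 13 ^ (a!3) + 17 ^ (a!4) - 19 ^ (a!5) = 0}
    = {[0,1,1,0,0,1], [1,0,0,1,0,1]}" (is "?S = ?T")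
  proof
    show "?S \<subseteq> ?T"
    proof
      fix x
      assume x: "x \<in> ?S"
      then obtain a b c d e f where "x = [a, b, c, d, e, f]"
        by (auto simp: numeral_eq_Suc length_Suc_conv)
      then show "x \<in> ?T"
        using x six_term_solutions[of a b c d e f] by simp
    qed
    show "?T \<subseteq> ?S"
      by auto
  qed
qed

end
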